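(* Let $D$ be a nuclear positive-definite self-adjoint operator on $E$ whose eigenvectors are the basis vectors of $\mathcal E$. If $D^{1/2}$ is not nuclear, then for any $t>0$ and $f\in\mathcal H_{\mathcal E}$ one has $\mathcal U_{tD}f=0$. At the same time, for any $f\in\mathcal H_{\mathcal E}$ the sequence $\mathcal U_{D_n}f$ converges in $\mathcal H_{\mathcal E}$ to zero as $n\to\infty$, that is, to $\mathcal U_Df$.
   Context: $E$ is an infinite-dimensional real separable Hilbert space with orthonormal basis $\mathcal E=\{e_k\}_{k\in\mathbb N}$; $x_k=(x,e_k)$. A block is a set $\Pi_{a,b}=\{x\in E: x_j\in[a_j,b_j)\ \forall j\}$ with $a,b\in\ell_\infty$, $a_j<b_j$; it is absolutely measurable if it is empty or $\sum_j\max\{0,\ln(b_j-a_j)\}<\infty$. Put $\lambda_{\mathcal E}(\Pi_{a,b})=\prod_j(b_j-a_j)$ if $\Pi_{a,b}\ne\emptyset$ (value $0$ if the product diverges to $0$), and $\lambda_{\mathcal E}(\emptyset)=0$. It is known that $\lambda_{\mathcal E}$ extends uniquely to a finitely additive shift-invariant measure on the ring generated by absolutely measurable blocks, and then to the completion $\mathcal R_{\mathcal E}$ of this ring. $\mathcal H_{\mathcal E}$ is the complex Hilbert space obtained by completing (modulo the null space) the space of finite sums $\sum c_k\chi_{B_k}$, $c_k\in\mathbb C$, $B_k\in\mathcal R_{\mathcal E}$ pairwise disjoint, in the norm $(\sum|c_k|^2\lambda_{\mathcal E}(B_k))^{1/2}$. For $h\in E$, $S_hf(x)=f(x-h)$ (unitary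 on $\mathcal H_{\mathcal E}$). For a nuclear diagonal operator $D\ge0$, $\mathcal U_{tD}f=\int_ES_hf\,d\nu_{tD}(h)$ (Pettis integral), where $\nu_{tD}$ is the centered Gaussian measure on $E$ with covariance operator $tD$, i.e. with Fourier transform $\exp(-\frac t2(D\xi,\xi))$; $\mathcal U_D$ is the value at $t=1$. $D_n=DP_n$, where $P_n$ is the orthogonal projection onto $\mathrm{span}(e_1,\dots,e_n)$. *)

theory Defs
  imports "HOL-Analysis.Analysis"
begin

section \<open>Complex Hilbert spaces\<close>

text \<open>The inner product is linear in the first argument; completeness comes from \<open>banach\<close>.\<close>

class complex_hilbert = banach +
  fixes scaleC :: "complex \<Rightarrow> 'a \<Rightarrow> 'a" (infixr "*\<^sub>C" 75)
    and cinner :: "'a \<Rightarrow> 'a \<Rightarrow> complex"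
  assumes scaleC_add_right: "c *\<^sub>C (x + y) = c *\<^sub>C x + c *\<^sub>C y"
    and scaleC_add_left: "(b + c) *\<^sub>C x = b *\<^sub>C x + c *\<^sub>C x"
    and scaleC_scaleC: "b *\<^sub>C c *\<^sub>C x = (b * c) *\<^sub>C x"
    and scaleC_complex_of_real: "complex_of_real r *\<^sub>C x = r *\<^sub>R x"
    and cinner_commute: "cinner x y = cnj (cinner y x)"
    and cinner_add_left: "cinner (x + y) z = cinner x z + cinner y z"
    and cinner_scaleC_left: "cinner (c *\<^sub>C x) y = c * cinner x y"
    and cinner_self: "cinner x x = complex_of_real ((norm x)\<^sup>2)"

section \<open>Operators on a real Hilbert space\<close>

definition orthonormal_basis :: "(nat \<Rightarrow> 'a::real_inner) \<Rightarrow> bool" where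
  "orthonormal_basis e \<longleftrightarrow>
     (\<forall>i j. e i \<bullet> e j = (if i = j then 1 else 0)) \<and> closure (span (range e)) = UNIV"

definition nuclear :: "('a::real_inner \<Rightarrow> 'a) \<Rightarrow> bool" where
  "nuclear A \<longleftrightarrow>
     (\<exists>u v. summable (\<lambda>k::nat. norm (u k) * norm (v k)) \<and>
            (\<forall>x. (\<lambda>k. (u k \<bullet> x) *\<^sub>R v k) sums A x))"

definition self_adjoint :: "('a::real_inner \<Rightarrow> 'a) \<Rightarrow> bool" where
  "self_adjoint A \<longleftrightarrow> bounded_linear A \<and> (\<forall>x y. A x \<bullet> y = x \<bullet> A y)"

definition positive_definite :: "('a::real_inner \<Rightarrow> 'a) \<Rightarrow> bool" where
  "positive_definite A \<longleftrightarrow> (\<forall>x. x \<noteq> 0 \<longrightarrow> A x \<bullet> x > 0)"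

definition operator_sqrt :: "('a::real_inner \<Rightarrow> 'a) \<Rightarrow> 'a \<Rightarrow> 'a" where
  "operator_sqrt A = (THE T. self_adjoint T \<and> (\<forall>x. T x \<bullet> x \<ge> 0) \<and> T \<circ> T = A)"

text \<open>Basis vectors are numbered from \<open>0\<close>, so the span of the first \<open>n\<close> of them
  is spanned by \<open>e k\<close> with \<open>k < n\<close>.\<close>

definition basis_proj :: "(nat \<Rightarrow> 'a::real_inner) \<Rightarrow> nat \<Rightarrow> 'a \<Rightarrow> 'a" where
  "basis_proj e n x = (\<Sum>k<n. (x \<bullet> e k) *\<^sub>R e k)"

section \<open>The shift-invariant finitely additive measure\<close>

definition block :: "(nat \<Rightarrow> 'a::real_inner) \<Rightarrow> (nat \<Rightarrow> real) \<Rightarrow> (nat \<Rightarrow> real) \<Rightarrow> 'a set" where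
  "block e a b = {x. \<forall>j. x \<bullet> e j \<in> {a j..<b j}}"

definition block_bounds :: "(nat \<Rightarrow> real) \<Rightarrow> (nat \<Rightarrow> real) \<Rightarrow> bool" where
  "block_bounds a b \<longleftrightarrow> bounded (range a) \<and> bounded (range b) \<and> (\<forall>j. a j < b j)"

definition abs_measurable_blocks :: "(nat \<Rightarrow> 'a::real_inner) \<Rightarrow> 'a set set" where
  "abs_measurable_blocks e =
     {block e a b | a b. block_bounds a b \<and>
        (block e a b = {} \<or> summable (\<lambda>j. max 0 (ln (b j - a j))))}"

definition block_ring :: "(nat \<Rightarrow> 'a::real_inner) \<Rightarrow> 'a set set" where
  "block_ring e = ring_of_sets UNIV hull abs_measurable_blocks e"

text \<open>The infinite product is the limit of the partial products. The library's \<open>prodinf\<close> does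
  not fit, because it does not regard a product diverging to \<open>0\<close> as having the value \<open>0\<close>.

  The predicate describes an extension of this product from the absolutely measurable blocks to the ring they
  generate; such an extension exists and is unique on that ring (values elsewhere are irrelevant).
  The second to last clause does not depend on the bounds chosen to describe a block: a nonempty
  block determines its bounds.\<close>

definition shift_invariant_measure ::
    "(nat \<Rightarrow> 'a::real_inner) \<Rightarrow> ('a set \<Rightarrow> real) \<Rightarrow> bool" where
  "shift_invariant_measure e \<mu> \<longleftrightarrow>
     (\<forall>A\<in>block_ring e. \<mu> A \<ge> 0) \<and>
     (\<forall>A\<in>block_ring e. \<forall>B\<in>block_ring e. A \<inter> B = {} \<longrightarrow> \<mu> (A \<union> B) = \<mu> A + \<mu> B) \<and>
     \<mu> {} = 0 \<and>
     (\<forall>a b. block_bounds a b \<longrightarrow> block e a b \<in> abs_measurable_blocks e \<longrightarrow> block e a b \<noteq> {} \<longrightarrow>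
        \<mu> (block e a b) = lim (\<lambda>n. \<Prod>j<n. b j - a j)) \<and>
     (\<forall>A\<in>block_ring e. \<forall>h. \<mu> ((+) h ` A) = \<mu> A)"

text \<open>Completion of a finitely additive measure: the sets whose inner and outer measures
  (taken over the ring) are finite and agree.\<close>

definition completed_ring :: "(nat \<Rightarrow> 'a::real_inner) \<Rightarrow> ('a set \<Rightarrow> real) \<Rightarrow> 'a set set" where
  "completed_ring e \<mu> =
     {A. \<forall>\<epsilon>>0. \<exists>B\<in>block_ring e. \<exists>C\<in>block_ring e. B \<subseteq> A \<and> A \<subseteq> C \<and> \<mu> (C - B) < \<epsilon>}"

definition completed_measure ::
    "(nat \<Rightarrow> 'a::real_inner) \<Rightarrow> ('a set \<Rightarrow> real) \<Rightarrow> 'a set \<Rightarrow> real" where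
  "completed_measure e \<mu> A = (INF C\<in>{C\<in>block_ring e. A \<subseteq> C}. \<mu> C)"

section \<open>The Hilbert space of square integrable functions\<close>

definition step_fun :: "nat \<Rightarrow> (nat \<Rightarrow> complex) \<Rightarrow> (nat \<Rightarrow> 'a set) \<Rightarrow> 'a \<Rightarrow> complex" where
  "step_fun n c B = (\<lambda>x. \<Sum>k<n. c k * indicator (B k) x)"

definition disjoint_sets_in :: "'a set set \<Rightarrow> nat \<Rightarrow> (nat \<Rightarrow> 'a set) \<Rightarrow> bool" where
  "disjoint_sets_in R n B \<longleftrightarrow> (\<forall>k<n. B k \<in> R) \<and> disjoint_family_on B {..<n}"

definition simple_funs ::
    "(nat \<Rightarrow> 'a::real_inner) \<Rightarrow> ('a set \<Rightarrow> real) \<Rightarrow> ('a \<Rightarrow> complex) set" where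
  "simple_funs e \<mu> = {step_fun n c B | n c B. disjoint_sets_in (completed_ring e \<mu>) n B}"

text \<open>\<open>\<iota>\<close> exhibits the type \<open>'h\<close> as the completion, modulo the null space, of the seminormed space
  of simple functions: it is linear and isometric (so its kernel is the null space) with dense
  range. Values of \<open>\<iota>\<close> outside the simple functions are irrelevant. This determines \<open>'h\<close>
  together with \<open>\<iota>\<close> up to a unique unitary isomorphism.\<close>

definition simple_funs_completion ::
    "(nat \<Rightarrow> 'a::real_inner) \<Rightarrow> ('a set \<Rightarrow> real) \<Rightarrow> (('a \<Rightarrow> complex) \<Rightarrow> 'h::complex_hilbert) \<Rightarrow> bool"
  where
  "simple_funs_completion e \<mu> \<iota> \<longleftrightarrow>
     (\<forall>f\<in>simple_funs e \<mu>. \<forall>g\<in>simple_funs e \<mu>. \<iota> (\<lambda>x. f x + g x) = \<iota> f + \<iota> g) \<and>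
     (\<forall>f\<in>simple_funs e \<mu>. \<forall>c. \<iota> (\<lambda>x. c * f x) = c *\<^sub>C \<iota> f) \<and>
     (\<forall>n c B. disjoint_sets_in (completed_ring e \<mu>) n B \<longrightarrow>
        norm (\<iota> (step_fun n c B)) = sqrt (\<Sum>k<n. (cmod (c k))\<^sup>2 * completed_measure e \<mu> (B k))) \<and>
     closure (\<iota> ` simple_funs e \<mu>) = UNIV"

text \<open>The shift on simple functions, extended by continuity.\<close>

definition shift_op ::
    "(nat \<Rightarrow> 'a::real_inner) \<Rightarrow> ('a set \<Rightarrow> real) \<Rightarrow> (('a \<Rightarrow> complex) \<Rightarrow> 'h::complex_hilbert) \<Rightarrow>
     'a \<Rightarrow> 'h \<Rightarrow> 'h" where
  "shift_op e \<mu> \<iota> h =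
     (THE T. continuous_on UNIV T \<and> (\<forall>f\<in>simple_funs e \<mu>. T (\<iota> f) = \<iota> (\<lambda>x. f (x - h))))"

section \<open>Averaging over a Gaussian measure\<close>

definition centered_gaussian :: "('a::real_inner \<Rightarrow> 'a) \<Rightarrow> 'a measure \<Rightarrow> bool" where
  "centered_gaussian C \<nu> \<longleftrightarrow>
     sets \<nu> = sets borel \<and> emeasure \<nu> (space \<nu>) = 1 \<and>
     (\<forall>\<xi>. (LINT x|\<nu>. exp (\<i> * complex_of_real (\<xi> \<bullet> x))) =
           complex_of_real (exp (- (C \<xi> \<bullet> \<xi>) / 2)))"

text \<open>On a separable Hilbert space a Borel probability measure is determined by its Fourier
  transform, so the choice operator makes no actual choice when \<open>C\<close> is nuclear and
  nonnegative.\<close>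

definition gaussian_measure :: "('a::real_inner \<Rightarrow> 'a) \<Rightarrow> 'a measure" where
  "gaussian_measure C = (SOME \<nu>. centered_gaussian C \<nu>)"

definition has_pettis_integral ::
    "'a measure \<Rightarrow> ('a \<Rightarrow> 'h::complex_hilbert) \<Rightarrow> 'h \<Rightarrow> bool" where
  "has_pettis_integral \<nu> F g \<longleftrightarrow>
     (\<forall>\<phi>. integrable \<nu> (\<lambda>h. cinner (F h) \<phi>) \<and> cinner g \<phi> = (LINT h|\<nu>. cinner (F h) \<phi>))"

definition pettis_integral :: "'a measure \<Rightarrow> ('a \<Rightarrow> 'h::complex_hilbert) \<Rightarrow> 'h" where
  "pettis_integral \<nu> F = (THE g. has_pettis_integral \<nu> F g)"

definition averaged_shift ::
    "(nat \<Rightarrow> 'a::real_inner) \<Rightarrow> ('a set \<Rightarrow> real) \<Rightarrow> (('a \<Rightarrow> complex) \<Rightarrow> 'h::complex_hilbert) \<Rightarrow>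
     ('a \<Rightarrow> 'a) \<Rightarrow> 'h \<Rightarrow> 'h" where
  "averaged_shift e \<mu> \<iota> C f = pettis_integral (gaussian_measure C) (\<lambda>h. shift_op e \<mu> \<iota> h f)"

end

theory Submission
  imports Defs "HOL-Probability.Characteristic_Functions" "HOL-Probability.Infinite_Product_Measure"
begin

text \<open>For blocks \<open>B\<close>, \<open>B'\<close> the inner product of the shifted indicators is the infinite product of the
  lengths of the overlaps of the shifted edges. Each overlap is at most a bounded constant times
  \<open>1 - \<kappa> \<sigma>\<^sub>k (1 - exp (- (h\<^sub>k - s\<^sub>k)\<^sup>2 / (2 \<sigma>\<^sub>k\<^sup>2)))\<close>, where \<open>\<sigma>\<^sub>k\<^sup>2\<close> is the variance of the \<open>k\<close>th coordinate \<open>h\<^sub>k\<close>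
  of the shift. As the coordinates are independent Gaussians, the mean of the product over \<open>k < N\<close> is bounded by a
  constant times \<open>\<Prod>k<N. 1 - \<kappa> \<sigma>\<^sub>k (1 - 1 / sqrt 2)\<close>, uniformly in the centres \<open>s\<^sub>k\<close>, and this
  tends to \<open>0\<close> because the \<open>\<sigma>\<^sub>k\<close>, up to a factor \<open>sqrt t\<close> the eigenvalues of \<open>D\<^sup>1\<^sup>/\<^sup>2\<close>, are not summable.
  Uniformity turns this weak estimate into convergence in norm.\<close>

section \<open>Riesz representation in complex Hilbert spaces\<close>

text \<open>The loss is linear in \<sigma> because the overlap of two intervals is at most their
  mean length less the distance of their midpoints, and that distance is typically of the order of
  the standard deviation or more; so nuclearity of the square root decides the matter, not that of
  \<open>D\<close>. The Gaussian profile stands in for the absolute value: it lies below it and is a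
  mixture of characters, so products of weights are integrated from the Fourier transform alone.
  Both claims come from one bound that looks only at the first \<open>N\<close> coordinates of the
  shift: for tD it holds for every \<open>N\<close> and forces the average to vanish, for D_n it
  holds with \<open>N = n\<close> and yields the limit. The vectors of the Hilbert space are not
  functions, so overlaps are computed only for indicators of blocks; sesquilinearity extends the
  bounds to their combinations, density and contractivity to all vectors. The Gaussian measure and
  the Pettis integral are given by choice and by description, so nothing is known of them before
  existence is proved; for the integral this is the purpose of Riesz representation.\<close>

lemma cinner_add_right: "cinner x (y + z) = cinner x y + cinner x z"
  for x :: "'h::complex_hilbert"
  by (metis cinner_add_left cinner_commute complex_cnj_add)

lemma cinner_scaleC_right: "cinner x (c *\<^sub>C y) = cnj c * cinner x y"
  for x :: "'h::complex_hilbert"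
  by (metis cinner_scaleC_left cinner_commute complex_cnj_mult)

lemma cinner_scaleR_left: "cinner (r *\<^sub>R x) y = of_real r * cinner x y"
  for x :: "'h::complex_hilbert"
  by (metis cinner_scaleC_left scaleC_complex_of_real)

lemma cinner_scaleR_right: "cinner x (r *\<^sub>R y) = of_real r * cinner x y"
  for x :: "'h::complex_hilbert"
  by (metis cinner_scaleC_right scaleC_complex_of_real complex_cnj_complex_of_real)

lemma cinner_zero_left [simp]: "cinner 0 x = 0"
  and cinner_zero_right [simp]: "cinner x 0 = 0" for x :: "'h::complex_hilbert"
  using cinner_scaleR_left[of 0 0 x] cinner_scaleR_right[of x 0 0] by auto

lemma cinner_minus_left: "cinner (- x) y = - cinner x y" for x :: "'h::complex_hilbert"
  using cinner_scaleR_left[of "-1" x y] by simp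

lemma cinner_minus_right: "cinner x (- y) = - cinner x y" for x :: "'h::complex_hilbert"
  using cinner_scaleR_right[of x "-1" y] by simp

lemma cinner_diff_left: "cinner (x - y) z = cinner x z - cinner y z"
  for x :: "'h::complex_hilbert"
  using cinner_add_left[of x "-y" z] by (simp add: cinner_minus_left)

lemma cinner_diff_right: "cinner x (y - z) = cinner x y - cinner x z"
  for x :: "'h::complex_hilbert"
  using cinner_add_right[of x y "-z"] by (simp add: cinner_minus_right)

lemma norm_scaleC: "norm (c *\<^sub>C x) = cmod c * norm x" for x :: "'h::complex_hilbert"
proof -
  have "complex_of_real ((norm (c *\<^sub>C x))\<^sup>2) = (c * cnj c) * complex_of_real ((norm x)\<^sup>2)"
    unfolding cinner_self[symmetric] by (simp add: cinner_scaleC_left cinner_scaleC_right)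
  also have "c * cnj c = complex_of_real ((cmod c)\<^sup>2)"
    using complex_norm_square[of c] by simp
  finally have "(norm (c *\<^sub>C x))\<^sup>2 = (cmod c * norm x)\<^sup>2"
    unfolding power_mult_distrib by (metis of_real_eq_iff of_real_mult)
  then show ?thesis by simp
qed

lemma norm_add_sq: "(norm (x + y))\<^sup>2 = (norm x)\<^sup>2 + (norm y)\<^sup>2 + 2 * Re (cinner x y)"
  for x :: "'h::complex_hilbert"
proof -
  have "complex_of_real ((norm (x + y))\<^sup>2) =
      complex_of_real ((norm x)\<^sup>2) + complex_of_real ((norm y)\<^sup>2) + (cinner x y + cnj (cinner x y))"
    unfolding cinner_self[symmetric] cinner_commute[of x y, symmetric]
    by (simp add: cinner_add_left cinner_add_right cinner_commute[of y x])
  also have "cinner x y + cnj (cinner x y) = complex_of_real (2 * Re (cinner x y))"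
    by (rule complex_add_cnj)
  finally show ?thesis by (metis of_real_eq_iff of_real_add)
qed

lemma cinner_Cauchy_Schwarz: "cmod (cinner x y) \<le> norm x * norm y"
  for x :: "'h::complex_hilbert"
proof (cases "y = 0")
  case False
  \<comment> \<open>The coefficient of the orthogonal projection of \<open>x\<close> onto
    \<open>y\<close>; the inequality is the nonnegativity of the squared norm of the
    remainder.\<close>
  define t where "t = cinner x y / complex_of_real ((norm y)\<^sup>2)"
  have ny: "(norm y)\<^sup>2 > 0" using False by simp
  have "cnj t * cinner x y = complex_of_real ((cmod (cinner x y))\<^sup>2 / (norm y)\<^sup>2)"
    using complex_norm_square[of "cinner x y"] by (simp add: t_def mult.commute)
  then have c: "cinner x ((- t) *\<^sub>C y) = complex_of_real (- ((cmod (cinner x y))\<^sup>2 / (norm y)\<^sup>2))"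
    by (simp add: cinner_scaleC_right)
  have n: "(norm ((- t) *\<^sub>C y))\<^sup>2 = (cmod (cinner x y))\<^sup>2 / (norm y)\<^sup>2"
    using ny by (simp add: norm_scaleC t_def norm_divide power2_eq_square norm_mult)
  have "0 \<le> (norm (x + (- t) *\<^sub>C y))\<^sup>2" by simp
  also have "\<dots> = (norm x)\<^sup>2 - (cmod (cinner x y))\<^sup>2 / (norm y)\<^sup>2"
    unfolding norm_add_sq n c Re_complex_of_real by simp
  finally have "(cmod (cinner x y))\<^sup>2 \<le> (norm x * norm y)\<^sup>2"
    using ny by (simp add: field_simps power_mult_distrib)
  then show ?thesis by (rule power2_le_imp_le) simp
qed simp

lemma cinner_eqI:
  fixes g g' :: "'h::complex_hilbert"
  assumes "\<And>\<phi>. cinner g \<phi> = cinner g' \<phi>"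
  shows "g = g'"
proof -
  have "cinner (g - g') (g - g') = 0" using assms by (simp add: cinner_diff_left)
  then show ?thesis by (simp add: cinner_self)
qed

lemma tendsto_cinner:
  fixes f g :: "'b \<Rightarrow> 'h::complex_hilbert"
  assumes f: "(f \<longlongrightarrow> x) F" and g: "(g \<longlongrightarrow> y) F"
  shows "((\<lambda>n. cinner (f n) (g n)) \<longlongrightarrow> cinner x y) F"
proof -
  have "((\<lambda>n. norm (f n) * norm (g n - y) + norm (f n - x) * norm y) \<longlongrightarrow>
      norm x * norm (y - y) + norm (x - x) * norm y) F"
    by (intro tendsto_intros f g)
  then have lim: "((\<lambda>n. norm (f n) * norm (g n - y) + norm (f n - x) * norm y) \<longlongrightarrow> 0) F" by simp
  have le: "cmod (cinner (f n) (g n) - cinner x y) \<le>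
      norm (f n) * norm (g n - y) + norm (f n - x) * norm y" for n
  proof -
    have "cinner (f n) (g n) - cinner x y = cinner (f n) (g n - y) + cinner (f n - x) y"
      by (simp add: cinner_diff_left cinner_diff_right)
    then show ?thesis
      by (metis norm_triangle_mono cinner_Cauchy_Schwarz)
  qed
  have "((\<lambda>n. cinner (f n) (g n) - cinner x y) \<longlongrightarrow> 0) F"
    by (rule Lim_null_comparison[OF always_eventually lim]) (use le in blast)
  then show ?thesis by (simp add: LIM_zero_iff)
qed

text \<open>The representing vector minimises \<open>\<parallel>x\<parallel>\<^sup>2 - 2 Re (F x)\<close>; the parallelogram law makes a
  minimising sequence Cauchy.\<close>

lemma riesz_representation:
  fixes F :: "'h::complex_hilbert \<Rightarrow> complex"
  assumes add: "\<And>x y. F (x + y) = F x + F y"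
    and scale: "\<And>c x. F (c *\<^sub>C x) = cnj c * F x"
    and bound: "\<And>x. cmod (F x) \<le> K * norm x"
  shows "\<exists>g. \<forall>\<phi>. F \<phi> = cinner g \<phi>"
proof -
  define J where "J x = (norm x)\<^sup>2 - 2 * Re (F x)" for x
  have scaleR: "F (r *\<^sub>R x) = of_real r * F x" for r x
    using scale[of "of_real r" x] by (simp add: scaleC_complex_of_real)
  have J_ge: "J x \<ge> - K\<^sup>2" for x
  proof -
    have "Re (F x) \<le> K * norm x" using bound[of x] complex_Re_le_cmod[of "F x"] by linarith
    moreover have "0 \<le> (norm x - K)\<^sup>2" by simp
    ultimately show ?thesis unfolding J_def power2_diff by (simp add: mult.commute)
  qed
  define m where "m = (INF x. J x)"
  have bdd: "bdd_below (range J)" by (rule bdd_belowI[of _ "- K\<^sup>2"]) (use J_ge in auto)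
  have m_le: "m \<le> J x" for x unfolding m_def by (rule cINF_lower[OF bdd]) simp
  have "\<exists>x. J x < m + 1 / real (Suc n)" for n
    using cINF_less_iff[of UNIV J "m + 1 / real (Suc n)"] bdd unfolding m_def by auto
  then obtain x where x: "\<And>n. J (x n) < m + 1 / real (Suc n)" by metis
  have par: "(norm (u - v))\<^sup>2 \<le> 2 * (J u - m) + 2 * (J v - m)" for u v
  proof -
    have "Re (F ((1/2) *\<^sub>R (u + v))) = (Re (F u) + Re (F v)) / 2"
      unfolding scaleR add by simp
    then have "J ((1/2) *\<^sub>R (u + v)) = (norm (u + v))\<^sup>2 / 4 - (Re (F u) + Re (F v))"
      unfolding J_def by (simp add: power_divide)
    moreover have "(norm (u - v))\<^sup>2 = 2 * (norm u)\<^sup>2 + 2 * (norm v)\<^sup>2 - (norm (u + v))\<^sup>2"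
      using norm_add_sq[of u v] norm_add_sq[of u "- v"] by (simp add: cinner_minus_right)
    ultimately have "(norm (u - v))\<^sup>2 = 2 * J u + 2 * J v - 4 * J ((1/2) *\<^sub>R (u + v))"
      by (simp add: J_def)
    then show ?thesis using m_le[of "(1/2) *\<^sub>R (u + v)"] by simp
  qed
  have "Cauchy x"
  proof (rule metric_CauchyI)
    fix e :: real assume e: "0 < e"
    obtain N :: nat where "N > 0" and N: "inverse (real N) < e\<^sup>2 / 4"
      using ex_inverse_of_nat_less[of "e\<^sup>2 / 4"] e by auto
    have "dist (x i) (x j) < e" if "i \<ge> N" "j \<ge> N" for i j
    proof -
      have "1 / real (Suc k) \<le> inverse (real N)" if "k \<ge> N" for k
        using that \<open>N > 0\<close> by (simp add: field_simps)
      then have "J (x i) - m < e\<^sup>2 / 4" "J (x j) - m < e\<^sup>2 / 4"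
        using x[of i] x[of j] N that by (smt (verit))+
      then have "2 * (J (x i) - m) + 2 * (J (x j) - m) < 2 * (e\<^sup>2 / 4) + 2 * (e\<^sup>2 / 4)"
        by (intro add_strict_mono mult_strict_left_mono) auto
      also have "\<dots> = e\<^sup>2" by simp
      finally have "(norm (x i - x j))\<^sup>2 < e\<^sup>2" using par[of "x i" "x j"] by (rule le_less_trans[rotated])
      then show ?thesis using e by (simp add: dist_norm power2_less_imp_less)
    qed
    then show "\<exists>M. \<forall>m\<ge>M. \<forall>n\<ge>M. dist (x m) (x n) < e" by blast
  qed
  then obtain g where g: "x \<longlonglongrightarrow> g" using Cauchy_convergent convergent_def by blast
  have F_lim: "(\<lambda>n. F (x n)) \<longlonglongrightarrow> F g"
  proof -
    have "cmod (F (x n) - F g) \<le> K * norm (x n - g)" for n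
      using bound[of "x n - g"] add[of "x n - g" g] by simp
    moreover have "(\<lambda>n. K * norm (x n - g)) \<longlonglongrightarrow> K * norm (g - g)"
      by (intro tendsto_intros g)
    then have "(\<lambda>n. K * norm (x n - g)) \<longlonglongrightarrow> 0" by simp
    ultimately have "(\<lambda>n. F (x n) - F g) \<longlonglongrightarrow> 0"
      by (rule Lim_null_comparison[OF always_eventually[OF allI]])
    then show ?thesis by (simp add: LIM_zero_iff)
  qed
  have "J g \<le> m"
  proof (rule LIMSEQ_le)
    show "(\<lambda>n. J (x n)) \<longlonglongrightarrow> J g" unfolding J_def by (intro tendsto_intros g F_lim)
    show "(\<lambda>n. m + 1 / real (Suc n)) \<longlonglongrightarrow> m"
      using tendsto_add[OF tendsto_const LIMSEQ_inverse_real_of_nat, of m] by (simp add: divide_inverse)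
    show "\<exists>N. \<forall>n\<ge>N. J (x n) \<le> m + 1 / real (Suc n)" using x less_imp_le by blast
  qed
  then have Jg: "J g \<le> J y" for y using m_le[of y] by linarith
  have Re_eq: "Re (F \<phi>) = Re (cinner g \<phi>)" for \<phi>
  proof (rule ccontr)
    assume ne: "Re (F \<phi>) \<noteq> Re (cinner g \<phi>)"
    define d where "d = Re (F \<phi>) - Re (cinner g \<phi>)"
    \<comment> \<open>Moving the minimiser by \<open>t\<close> along \<open>\<phi>\<close> changes
      \<open>J\<close> by \<open>t\<^sup>2 * (norm \<phi>)\<^sup>2 - 2 * t * d\<close>. The added
      \<open>1\<close> keeps the denominator positive when \<open>\<phi> = 0\<close>.\<close>
    define t where "t = d / (1 + (norm \<phi>)\<^sup>2)"
    have pos: "1 + (norm \<phi>)\<^sup>2 > 0" by (simp add: add_pos_nonneg)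
    have "J (g + t *\<^sub>R \<phi>) = J g + t\<^sup>2 * (norm \<phi>)\<^sup>2 - 2 * t * d"
      unfolding J_def norm_add_sq add scaleR cinner_scaleR_right d_def
      by (simp add: power_mult_distrib algebra_simps)
    with Jg[of "g + t *\<^sub>R \<phi>"] have "2 * t * d \<le> t\<^sup>2 * (norm \<phi>)\<^sup>2" by simp
    also have "\<dots> \<le> t\<^sup>2 * (1 + (norm \<phi>)\<^sup>2)" by (simp add: mult_left_mono)
    also have "\<dots> = t * d" unfolding t_def using pos by (simp add: power2_eq_square)
    finally have "t * d \<le> 0" by linarith
    moreover have "t * d > 0" unfolding t_def d_def using ne pos
      by (simp add: zero_less_mult_iff zero_less_divide_iff divide_less_0_iff) linarith
    ultimately show False by simp
  qed
  \<comment> \<open>\<open>J\<close> involves only the real part of \<open>F\<close>. The imaginary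
    part at \<open>\<phi>\<close> is the real part at \<open>\<i> *\<^sub>C \<phi>\<close>, as both
    sides are conjugate linear.\<close>
  have "F \<phi> = cinner g \<phi>" for \<phi>
    using Re_eq[of \<phi>] Re_eq[of "\<i> *\<^sub>C \<phi>"]
    by (intro complex_eqI) (simp_all add: scale cinner_scaleC_right)
  then show ?thesis by blast
qed

section \<open>Orthonormal expansions and diagonal operators\<close>

locale onb =
  fixes e :: "nat \<Rightarrow> 'a::{real_inner, complete_space}"
  assumes onb: "orthonormal_basis e"
begin

lemma inner_basis: "e i \<bullet> e j = (if i = j then 1 else 0)"
  using onb by (simp add: orthonormal_basis_def)

lemma inner_sum_basis: "finite A \<Longrightarrow> (\<Sum>k\<in>A. c k *\<^sub>R e k) \<bullet> e j = (if j \<in> A then c j else 0)"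
  by (simp add: inner_sum_left inner_basis if_distrib cong: if_cong)

lemma inner_sum_sum_basis:
  "finite A \<Longrightarrow> (\<Sum>k\<in>A. c k *\<^sub>R e k) \<bullet> (\<Sum>k\<in>A. b k *\<^sub>R e k) = (\<Sum>k\<in>A. c k * b k)"
  by (simp add: inner_sum_right inner_sum_basis mult.commute)

lemma inner_basis_proj: "basis_proj e n x \<bullet> e j = (if j < n then x \<bullet> e j else 0)"
  by (simp add: basis_proj_def inner_sum_basis)

lemma norm_basis_proj_compl_le: "norm (x - basis_proj e n x) \<le> norm x"
proof -
  let ?p = "basis_proj e n x"
  have "x \<bullet> ?p = ?p \<bullet> ?p"
    unfolding basis_proj_def by (simp add: inner_sum_right inner_sum_basis)
  then have "(norm (x - ?p))\<^sup>2 + ?p \<bullet> ?p = (norm x)\<^sup>2"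
    by (simp add: power2_norm_eq_inner inner_diff_left inner_diff_right inner_commute)
  then have "(norm (x - ?p))\<^sup>2 \<le> (norm x)\<^sup>2" using inner_ge_zero[of ?p] by linarith
  then show ?thesis by simp
qed

lemma basis_proj_diff: "basis_proj e n (x - y) = basis_proj e n x - basis_proj e n y"
  by (simp add: basis_proj_def inner_diff_left scaleR_diff_left sum_subtractf)

lemma basis_proj_add: "basis_proj e n (x + y) = basis_proj e n x + basis_proj e n y"
  by (simp add: basis_proj_def inner_add_left scaleR_add_left sum.distrib)

text \<open>On the span of the basis the projections are eventually the identity, and the remainder
  of \<open>x - y\<close> is no longer than \<open>x - y\<close> itself, so density of the span
  suffices.\<close>

lemma basis_proj_LIMSEQ: "(\<lambda>n. basis_proj e n x) \<longlonglongrightarrow> x"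
proof -
  define S where "S = {y. \<forall>\<^sub>F n in sequentially. basis_proj e n y = y}"
  have "subspace S"
  proof (rule subspaceI)
    show "0 \<in> S" by (simp add: S_def basis_proj_def)
  next
    fix u v assume "u \<in> S" "v \<in> S"
    then have "\<forall>\<^sub>F n in sequentially. basis_proj e n u = u \<and> basis_proj e n v = v"
      unfolding S_def by (simp add: eventually_conj)
    then have "\<forall>\<^sub>F n in sequentially. basis_proj e n (u + v) = u + v"
      by eventually_elim (simp add: basis_proj_add)
    then show "u + v \<in> S" by (simp add: S_def)
  next
    fix c u assume "u \<in> S"
    then have "\<forall>\<^sub>F n in sequentially. basis_proj e n u = u" by (simp add: S_def)
    moreover have "basis_proj e n (c *\<^sub>R u) = c *\<^sub>R basis_proj e n u" for n
      by (simp add: basis_proj_def scaleR_sum_right)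
    ultimately show "c *\<^sub>R u \<in> S" by (auto simp add: S_def elim: eventually_mono)
  qed
  moreover have "e j \<in> S" for j
  proof -
    have "basis_proj e n (e j) = e j" if "n > j" for n
    proof -
      have "basis_proj e n (e j) = (\<Sum>k<n. if k = j then e k else 0)"
        unfolding basis_proj_def by (rule sum.cong) (auto simp: inner_basis)
      then show ?thesis using that by simp
    qed
    then show ?thesis unfolding S_def mem_Collect_eq eventually_sequentially
      by (intro exI[of _ "Suc j"]) simp
  qed
  ultimately have span: "span (range e) \<subseteq> S" by (intro span_minimal) auto
  show ?thesis
  proof (rule metric_LIMSEQ_I)
    fix r :: real assume r: "0 < r"
    have "x \<in> closure (span (range e))" using onb by (simp add: orthonormal_basis_def)
    then obtain y where y: "y \<in> span (range e)" "dist y x < r"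
      using r by (meson closure_approachable)
    then obtain N where N: "\<And>n. n \<ge> N \<Longrightarrow> basis_proj e n y = y"
      using span unfolding S_def eventually_sequentially by blast
    have "dist (basis_proj e n x) x < r" if "n \<ge> N" for n
    proof -
      have "dist (basis_proj e n x) x = norm ((x - y) - basis_proj e n (x - y))"
        by (simp add: basis_proj_diff N that dist_norm norm_minus_commute)
      also have "\<dots> \<le> norm (x - y)" by (rule norm_basis_proj_compl_le)
      finally show ?thesis using y by (simp add: dist_norm norm_minus_commute)
    qed
    then show "\<exists>N. \<forall>n\<ge>N. dist (basis_proj e n x) x < r" by blast
  qed
qed

lemma expansion_sums: "(\<lambda>k. (x \<bullet> e k) *\<^sub>R e k) sums x"
  using basis_proj_LIMSEQ[of x] by (simp add: sums_def basis_proj_def)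

lemma parseval: "(\<lambda>k. (x \<bullet> e k) * (y \<bullet> e k)) sums (x \<bullet> y)"
proof -
  have "(\<lambda>n. basis_proj e n x \<bullet> basis_proj e n y) \<longlonglongrightarrow> x \<bullet> y"
    by (intro tendsto_inner basis_proj_LIMSEQ)
  then show ?thesis by (simp add: sums_def basis_proj_def inner_sum_sum_basis)
qed

lemma parseval_norm: "(\<lambda>k. (x \<bullet> e k)\<^sup>2) sums (norm x)\<^sup>2"
  using parseval[of x x] unfolding power2_norm_eq_inner unfolding power2_eq_square .

lemma bessel: "(\<Sum>k<n. (x \<bullet> e k)\<^sup>2) \<le> (norm x)\<^sup>2"
  using sum_le_suminf[OF sums_summable[OF parseval_norm[of x]], of "{..<n}"]
    sums_unique[OF parseval_norm[of x]] by simp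

lemma coord_eqI: "(\<And>k. x \<bullet> e k = y \<bullet> e k) \<Longrightarrow> x = y"
  using expansion_sums[of x] expansion_sums[of y] by (auto intro: sums_unique2)

lemma abs_coord_le: "\<bar>x \<bullet> e k\<bar> \<le> norm x"
  using Cauchy_Schwarz_ineq2[of x "e k"] inner_basis[of k k] by (simp add: norm_eq_sqrt_inner)

lemma riesz_fischer_sums:
  assumes "summable (\<lambda>k. (c k)\<^sup>2)"
  obtains x where "(\<lambda>k. c k *\<^sub>R e k) sums x" "\<And>k. x \<bullet> e k = c k"
proof -
  define s where "s n = (\<Sum>k<n. c k *\<^sub>R e k)" for n
  \<comment> \<open>By orthogonality, squared distances of the vector partial sums are distances of
    the real ones, so the Cauchy property passes from numbers to vectors.\<close>
  have dist: "(dist (s m) (s n))\<^sup>2 = \<bar>(\<Sum>k<m. (c k)\<^sup>2) - (\<Sum>k<n. (c k)\<^sup>2)\<bar>" for m n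
  proof (induction m n rule: linorder_wlog)
    case (le m n)
    have "{..<n} = {..<m} \<union> {m..<n}" "{..<m} \<inter> {m..<n} = {}" using le by auto
    then have *: "sum g {..<n} - sum g {..<m} = sum g {m..<n}" for g :: "nat \<Rightarrow> 'b::ab_group_add"
      by (simp add: sum.union_disjoint)
    have "(dist (s m) (s n))\<^sup>2 = (norm (s n - s m))\<^sup>2" by (simp add: dist_norm norm_minus_commute)
    also have "s n - s m = (\<Sum>k=m..<n. c k *\<^sub>R e k)" unfolding s_def by (rule *)
    also have "(norm \<dots>)\<^sup>2 = (\<Sum>k=m..<n. (c k)\<^sup>2)"
      unfolding power2_norm_eq_inner inner_sum_sum_basis[OF finite_atLeastLessThan]
      by (simp only: power2_eq_square)
    also have "\<dots> = \<bar>(\<Sum>k<n. (c k)\<^sup>2) - (\<Sum>k<m. (c k)\<^sup>2)\<bar>" by (simp add: * sum_nonneg)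
    finally show ?case by (simp add: abs_minus_commute)
  qed (simp add: dist_commute abs_minus_commute)
  have "Cauchy (\<lambda>n. \<Sum>k<n. (c k)\<^sup>2)"
    using assms by (simp add: summable_iff_convergent convergent_Cauchy)
  have "Cauchy s"
  proof (rule metric_CauchyI)
    fix r :: real assume r: "0 < r"
    then obtain M where M: "\<forall>m\<ge>M. \<forall>n\<ge>M. dist (\<Sum>k<m. (c k)\<^sup>2) (\<Sum>k<n. (c k)\<^sup>2) < r\<^sup>2"
      using metric_CauchyD[OF \<open>Cauchy (\<lambda>n. \<Sum>k<n. (c k)\<^sup>2)\<close>, of "r\<^sup>2"] by auto
    have "dist (s m) (s n) < r" if "m \<ge> M" "n \<ge> M" for m n
    proof (rule power2_less_imp_less)
      show "(dist (s m) (s n))\<^sup>2 < r\<^sup>2" unfolding dist using M that by (simp add: dist_real_def)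
    qed (use r in simp)
    then show "\<exists>M. \<forall>m\<ge>M. \<forall>n\<ge>M. dist (s m) (s n) < r" by blast
  qed
  then obtain x where x: "s \<longlonglongrightarrow> x" using Cauchy_convergent convergent_def by blast
  have "x \<bullet> e k = c k" for k
  proof (rule LIMSEQ_unique)
    show "(\<lambda>n. s n \<bullet> e k) \<longlonglongrightarrow> x \<bullet> e k" by (intro tendsto_intros x)
    have "\<forall>\<^sub>F n in sequentially. c k = s n \<bullet> e k"
      using eventually_gt_at_top[of k] by eventually_elim (simp add: s_def inner_sum_basis)
    then show "(\<lambda>n. s n \<bullet> e k) \<longlonglongrightarrow> c k"
      by (rule Lim_transform_eventually[OF tendsto_const])
  qed
  then show thesis using x that by (auto simp: sums_def s_def[abs_def])
qed

section \<open>Diagonal operators: summable eigenvalues and the positive square root\<close>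

lemma self_adjoint_diagonal_coord:
  assumes "self_adjoint D" "\<And>k. D (e k) = d k *\<^sub>R e k"
  shows "D x \<bullet> e k = d k * (x \<bullet> e k)"
proof -
  have "D x \<bullet> e k = x \<bullet> D (e k)" using assms(1) by (auto simp: self_adjoint_def)
  then show ?thesis by (simp add: assms(2))
qed

text \<open>Partial traces are bounded: the diagonal entries are expanded along a nuclear
  representation, the finite sum over \<open>k\<close> is moved inside the series over
  \<open>j\<close>, and each term is estimated by Cauchy-Schwarz for the projected vectors.\<close>

lemma summable_eigenvalues_nuclear:
  assumes "nuclear D" "\<And>k. D (e k) = d k *\<^sub>R e k" "\<And>k. d k \<ge> 0"
  shows "summable d"
proof -
  obtain u v where uv: "summable (\<lambda>k::nat. norm (u k) * norm (v k))"
    and D: "\<And>x. (\<lambda>k. (u k \<bullet> x) *\<^sub>R v k) sums D x"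
    using assms(1) by (auto simp: nuclear_def)
  have ser: "(\<lambda>j. (u j \<bullet> e k) * (v j \<bullet> e k)) sums d k" for k
    using bounded_linear.sums[OF bounded_linear_inner_left D[of "e k"], of "e k"] by (simp add: assms(2) inner_basis)
  have bd: "\<bar>\<Sum>k<n. (u j \<bullet> e k) * (v j \<bullet> e k)\<bar> \<le> norm (u j) * norm (v j)" for n j
  proof -
    have "\<bar>\<Sum>k<n. (u j \<bullet> e k) * (v j \<bullet> e k)\<bar> = \<bar>basis_proj e n (u j) \<bullet> basis_proj e n (v j)\<bar>"
      by (simp add: basis_proj_def inner_sum_sum_basis)
    also have "\<dots> \<le> norm (basis_proj e n (u j)) * norm (basis_proj e n (v j))"
      by (rule Cauchy_Schwarz_ineq2)
    also have "\<dots> \<le> norm (u j) * norm (v j)"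
    proof -
      have "norm (basis_proj e n x) \<le> norm x" for x
      proof (rule power2_le_imp_le)
        have "(norm (basis_proj e n x))\<^sup>2 = (\<Sum>k<n. (x \<bullet> e k)\<^sup>2)"
          unfolding power2_norm_eq_inner unfolding basis_proj_def inner_sum_sum_basis[OF finite_lessThan]
          by (simp only: power2_eq_square)
        then show "(norm (basis_proj e n x))\<^sup>2 \<le> (norm x)\<^sup>2" using bessel[of x n] by simp
      qed simp
      then show ?thesis by (intro mult_mono) auto
    qed
    finally show ?thesis .
  qed
  have "(\<Sum>k<n. d k) \<le> (\<Sum>j. norm (u j) * norm (v j))" for n
  proof (rule sums_le)
    show "(\<lambda>j. \<Sum>k<n. (u j \<bullet> e k) * (v j \<bullet> e k)) sums (\<Sum>k<n. d k)" by (rule sums_sum) (rule ser)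
    show "(\<lambda>j. norm (u j) * norm (v j)) sums (\<Sum>j. norm (u j) * norm (v j))"
      using uv by (rule summable_sums)
    show "(\<Sum>k<n. (u j \<bullet> e k) * (v j \<bullet> e k)) \<le> norm (u j) * norm (v j)" for j
      using bd[of j n] by linarith
  qed
  then show ?thesis by (rule summableI_nonneg_bounded[OF assms(3)])
qed

text \<open>Supplies the candidate for the square root of \<open>D\<close>. Bounded coefficients
  preserve square summability, so Riesz-Fischer provides the values.\<close>

lemma diagonal_operator_exists:
  assumes "\<And>k. \<bar>c k\<bar> \<le> K"
  obtains T where "self_adjoint T" "\<And>x k. T x \<bullet> e k = c k * (x \<bullet> e k)"
proof -
  have le: "(c k * (x \<bullet> e k))\<^sup>2 \<le> K\<^sup>2 * (x \<bullet> e k)\<^sup>2" for x k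
    unfolding power_mult_distrib using assms[of k] by (intro mult_right_mono) (auto intro: abs_le_square_iff[THEN iffD1])
  have "summable (\<lambda>k. (c k * (x \<bullet> e k))\<^sup>2)" for x
    by (rule summable_comparison_test'[OF summable_mult[OF sums_summable[OF parseval_norm[of x]], of "K\<^sup>2"]])
      (use le in auto)
  then have "\<exists>y. \<forall>k. y \<bullet> e k = c k * (x \<bullet> e k)" for x by (metis riesz_fischer_sums)
  then obtain T where T: "\<And>x k. T x \<bullet> e k = c k * (x \<bullet> e k)" by metis
  have "bounded_linear T"
  proof (rule bounded_linear_intro)
    show "T (x + y) = T x + T y" for x y by (rule coord_eqI) (simp add: T inner_add_left distrib_left)
    show "T (r *\<^sub>R x) = r *\<^sub>R T x" for r x by (rule coord_eqI) (simp add: T)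
    show "norm (T x) \<le> norm x * K" for x
    proof (rule power2_le_imp_le)
      have "(norm (T x))\<^sup>2 \<le> K\<^sup>2 * (norm x)\<^sup>2"
        by (rule sums_le[OF _ parseval_norm sums_mult[OF parseval_norm]]) (use le T in auto)
      then show "(norm (T x))\<^sup>2 \<le> (norm x * K)\<^sup>2" by (simp add: power_mult_distrib mult.commute)
      show "0 \<le> norm x * K" using assms[of 0] by simp
    qed
  qed
  moreover have "T x \<bullet> y = x \<bullet> T y" for x y
    by (rule sums_unique2[OF parseval[of "T x" y]])
      (use parseval[of x "T y"] in \<open>simp add: T mult.left_commute mult.assoc\<close>)
  ultimately have "self_adjoint T" by (simp add: self_adjoint_def)
  then show thesis using T that by blast
qed

text \<open>\<open>operator_sqrt\<close> is a definite description, so the diagonal root must be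
  shown to be the only nonnegative self-adjoint one before its coordinates can be read off.\<close>

lemma operator_sqrt_coord:
  assumes D: "self_adjoint D" "\<And>k. D (e k) = d k *\<^sub>R e k" and d: "\<And>k. d k > 0" "summable d"
  shows "operator_sqrt D x \<bullet> e k = sqrt (d k) * (x \<bullet> e k)"
proof -
  have "\<bar>sqrt (d k)\<bar> \<le> sqrt (suminf d)" for k
    using sum_le_suminf[OF d(2), of "{k}"] d(1) by (auto simp: less_imp_le)
  then obtain T where T: "self_adjoint T" "\<And>x k. T x \<bullet> e k = sqrt (d k) * (x \<bullet> e k)"
    using diagonal_operator_exists[of "\<lambda>k. sqrt (d k)"] by metis
  have Tpos: "T x \<bullet> x \<ge> 0" for x
    by (rule sums_le[OF _ sums_zero parseval[of "T x" x]]) (simp add: T mult.assoc less_imp_le[OF d(1)])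
  have TT: "T \<circ> T = D"
  proof
    show "(T \<circ> T) x = D x" for x
    proof (rule coord_eqI)
      have "sqrt (d k) * sqrt (d k) = d k" for k using d(1)[of k] by simp
      then show "(T \<circ> T) x \<bullet> e k = D x \<bullet> e k" for k
        by (simp add: T(2) self_adjoint_diagonal_coord[of D d, OF D] mult.assoc[symmetric])
    qed
  qed
  have uniq: "S = T" if S: "self_adjoint S" "\<forall>x. S x \<bullet> x \<ge> 0" "S \<circ> S = D" for S
  proof -
    interpret S: bounded_linear S using S(1) by (simp add: self_adjoint_def)
    have Se: "S (e k) = sqrt (d k) *\<^sub>R e k" for k
    proof -
      \<comment> \<open>The defect of \<open>S\<close> from the expected eigenvalue equation. It is
        annihilated by \<open>S + sqrt (d k)\<close>; as \<open>S\<close> is nonnegative and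
        \<open>sqrt (d k)\<close> positive, it vanishes.\<close>
      define w where "w = S (e k) - sqrt (d k) *\<^sub>R e k"
      have "S (S (e k)) = d k *\<^sub>R e k" using S(3) D(2)[of k] by (metis comp_apply)
      then have "S w + sqrt (d k) *\<^sub>R w = 0"
        using d(1)[of k] by (simp add: w_def S.diff S.scaleR scaleR_diff_right)
      then have "(S w + sqrt (d k) *\<^sub>R w) \<bullet> w = 0" by simp
      then have "S w \<bullet> w + sqrt (d k) * (w \<bullet> w) = 0" by (simp add: inner_add_left)
      moreover have "S w \<bullet> w \<ge> 0" using S(2) by blast
      moreover have "sqrt (d k) * (w \<bullet> w) \<ge> 0" using d(1)[of k] by simp
      ultimately have "sqrt (d k) * (w \<bullet> w) = 0" by linarith
      then have "w = 0" using d(1)[of k] by simp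
      then show ?thesis by (simp add: w_def)
    qed
    show ?thesis
    proof
      show "S x = T x" for x
        by (rule coord_eqI)
          (simp add: T(2) self_adjoint_diagonal_coord[of S "\<lambda>k. sqrt (d k)", OF S(1) Se])
    qed
  qed
  have "operator_sqrt D = T"
    unfolding operator_sqrt_def
  proof (rule the_equality)
    show "self_adjoint T \<and> (\<forall>x. 0 \<le> T x \<bullet> x) \<and> T \<circ> T = D" using T(1) Tpos TT by blast
  qed (use uniq in blast)
  then show ?thesis by (simp add: T)
qed

lemma not_summable_sqrt_eigenvalues:
  assumes D: "self_adjoint D" "\<And>k. D (e k) = d k *\<^sub>R e k" and d: "\<And>k. d k > 0" "summable d"
    and nn: "\<not> nuclear (operator_sqrt D)"
  shows "\<not> summable (\<lambda>k. sqrt (d k))"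
proof
  assume s: "summable (\<lambda>k. sqrt (d k))"
  have "norm (sqrt (d k) *\<^sub>R e k) * norm (e k) = sqrt (d k)" for k
    using d(1)[of k] inner_basis[of k k] by (simp add: norm_eq_sqrt_inner)
  then have "summable (\<lambda>k. norm (sqrt (d k) *\<^sub>R e k) * norm (e k))" using s by presburger
  moreover have "(\<lambda>k. (sqrt (d k) *\<^sub>R e k \<bullet> x) *\<^sub>R e k) sums operator_sqrt D x" for x
    using expansion_sums[of "operator_sqrt D x"]
    by (simp add: operator_sqrt_coord[OF D d] inner_commute[of "e _"])
  ultimately have "nuclear (operator_sqrt D)" unfolding nuclear_def by (intro exI conjI allI)
  then show False using nn by simp
qed

end

section \<open>Gaussian measures with diagonal covariance\<close>

context onb begin

text \<open>The sort of \<open>'a\<close> does not include second countability, so partial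
  expansions are treated as continuous images of the coordinate sequence and not as sums of
  measurable maps; \<open>X\<close> is their pointwise limit.\<close>

lemma borel_measurable_coordI:
  fixes X :: "'b \<Rightarrow> 'a"
  assumes "\<And>k. (\<lambda>\<omega>. X \<omega> \<bullet> e k) \<in> borel_measurable M"
  shows "X \<in> borel_measurable M"
proof (rule borel_measurable_LIMSEQ_metric)
  fix n
  have "continuous_on UNIV (\<lambda>v :: nat \<Rightarrow> real. \<Sum>k<n. v k *\<^sub>R e k)"
    by (intro continuous_intros) (auto intro: continuous_on_product_coordinates)
  then have "(\<lambda>v :: nat \<Rightarrow> real. \<Sum>k<n. v k *\<^sub>R e k) \<in> borel_measurable borel"
    by (rule borel_measurable_continuous_onI)
  moreover have "(\<lambda>\<omega> k. X \<omega> \<bullet> e k) \<in> borel_measurable M"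
    by (rule measurable_coordinatewise_then_product) (rule assms)
  ultimately show "(\<lambda>\<omega>. basis_proj e n (X \<omega>)) \<in> borel_measurable M"
    unfolding basis_proj_def using measurable_compose by blast
qed (rule basis_proj_LIMSEQ)

end

section \<open>Independent standard normal variables and the Gaussian measure they generate\<close>

lemma borel_measurable_exp_inner:
  "(\<lambda>x. exp (\<i> * complex_of_real (\<xi> \<bullet> x))) \<in> borel_measurable (borel :: 'a::real_inner measure)"
  by (intro borel_measurable_continuous_onI continuous_intros)

lemma integral_std_normal_iexp:
  "(LINT x|std_normal_distribution. exp (\<i> * complex_of_real (t * x))) = complex_of_real (exp (- t\<^sup>2 / 2))"
  using fun_cong[OF char_std_normal_distribution, of t] by (simp add: char_def)

lemma nn_integral_std_normal_sq: "(\<integral>\<^sup>+x. ennreal (x\<^sup>2) \<partial>std_normal_distribution) = 1"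
  using std_normal_distribution_even_moments[of 1]
  by (subst nn_integral_eq_integral) (simp_all add: ennreal_1[symmetric] del: ennreal_1)

lemma product_prob_space_std_normal:
  "product_prob_space (\<lambda>_::nat. std_normal_distribution)"
  by (simp add: product_prob_space_def product_sigma_finite_def product_prob_space_axioms_def
      prob_space_imp_sigma_finite prob_space_normal_density)

abbreviation std_normals :: "(nat \<Rightarrow> real) measure" where
  "std_normals \<equiv> PiM UNIV (\<lambda>_. std_normal_distribution)"

lemma measurable_std_normals_coord:
  assumes "k \<in> J"
  shows "(\<lambda>\<omega>. \<omega> k) \<in> borel_measurable (PiM J (\<lambda>_. std_normal_distribution))"
proof -
  have "(\<lambda>\<omega>. \<omega> k) \<in> measurable (PiM J (\<lambda>_. std_normal_distribution)) std_normal_distribution"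
    using assms by (rule measurable_component_singleton)
  then show ?thesis by simp
qed

lemmas [measurable] = measurable_std_normals_coord[OF UNIV_I]

text \<open>The sum sees only the coordinates below \<open>n\<close>, so the integral passes to a
  finite product measure, where the factors separate.\<close>

lemma integral_std_normals_iexp:
  "(LINT \<omega>|std_normals. exp (\<i> * complex_of_real (\<Sum>k<n. a k * \<omega> k))) =
     complex_of_real (exp (- (\<Sum>k<n. (a k)\<^sup>2) / 2))"
proof -
  let ?G = "std_normal_distribution" let ?J = "{..<n}"
  have fin: "finite_measure ?G"
    by (rule prob_space.finite_measure) (simp add: prob_space_normal_density)
  interpret std_normals: product_prob_space "\<lambda>_::nat. std_normal_distribution" UNIV
    by (rule product_prob_space_std_normal)
  let ?f = "\<lambda>k x. exp (\<i> * complex_of_real (a k * x))"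
  have int: "integrable ?G (?f k)" for k
    by (rule finite_measure.integrable_const_bound[OF fin, of _ 1]) auto
  have "exp (\<i> * complex_of_real (\<Sum>k<n. a k * \<omega> k)) = (\<Prod>k<n. ?f k (restrict \<omega> ?J k))" for \<omega>
    by (simp add: sum_distrib_left exp_sum)
  then have "(LINT \<omega>|std_normals. exp (\<i> * complex_of_real (\<Sum>k<n. a k * \<omega> k))) =
      (LINT \<omega>|std_normals. (\<Prod>k<n. ?f k (restrict \<omega> ?J k)))" by presburger
  also have "\<dots> = (LINT \<omega>|distr std_normals (PiM ?J (\<lambda>_. ?G)) (\<lambda>\<omega>. restrict \<omega> ?J). (\<Prod>k<n. ?f k (\<omega> k)))"
  proof (rule integral_distr[symmetric])
    show "(\<lambda>\<omega>. restrict \<omega> ?J) \<in> measurable std_normals (PiM ?J (\<lambda>_. ?G))"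
      by (rule measurable_restrict_subset) simp
    have [measurable]: "(\<lambda>\<omega>. \<omega> k) \<in> borel_measurable (PiM ?J (\<lambda>_. ?G))" if "k \<in> ?J" for k
      using that by (rule measurable_std_normals_coord)
    show "(\<lambda>\<omega>. \<Prod>k<n. ?f k (\<omega> k)) \<in> borel_measurable (PiM ?J (\<lambda>_. ?G))"
      by measurable
  qed
  also have "\<dots> = (LINT \<omega>|PiM ?J (\<lambda>_. ?G). (\<Prod>k<n. ?f k (\<omega> k)))"
    by (subst std_normals.distr_PiM_restrict_finite) auto
  also have "\<dots> = (\<Prod>k<n. LINT x|?G. ?f k x)"
    by (rule std_normals.product_integral_prod) (use int in auto)
  also have "\<dots> = (\<Prod>k<n. complex_of_real (exp (- (a k)\<^sup>2 / 2)))"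
    by (simp only: integral_std_normal_iexp)
  also have "\<dots> = complex_of_real (exp (\<Sum>k<n. - (a k)\<^sup>2 / 2))" 
    by (simp only: exp_sum finite_lessThan of_real_prod)
  finally show ?thesis by (simp add: sum_divide_distrib sum_negf)
qed

lemma (in onb) centered_gaussian_exists:
  assumes c: "\<And>k. c k \<ge> 0" "summable c"
    and C: "\<And>\<xi>. (\<lambda>k. c k * (\<xi> \<bullet> e k)\<^sup>2) sums (C \<xi> \<bullet> \<xi>)"
  shows "\<exists>\<nu>. centered_gaussian C \<nu>"
proof -
  let ?G = "std_normal_distribution"
  interpret std_normals: product_prob_space "\<lambda>_::nat. std_normal_distribution" UNIV
    by (rule product_prob_space_std_normal)
  \<comment> \<open>The sum is taken in \<open>ennreal\<close>, where it exists for every sequence,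
    so that its finiteness is a measurable predicate.\<close>
  define fin where "fin \<omega> \<longleftrightarrow> (\<Sum>k. ennreal (c k * (\<omega> k)\<^sup>2)) \<noteq> \<infinity>" for \<omega> :: "nat \<Rightarrow> real"
  have [measurable]: "Measurable.pred std_normals fin" unfolding fin_def by measurable
  have coord: "(\<integral>\<^sup>+\<omega>. ennreal (c k * (\<omega> k)\<^sup>2) \<partial>std_normals) = ennreal (c k)" for k
  proof -
    have "(\<integral>\<^sup>+\<omega>. ennreal (c k * (\<omega> k)\<^sup>2) \<partial>std_normals) =
        (\<integral>\<^sup>+x. ennreal (c k * x\<^sup>2) \<partial>distr std_normals ?G (\<lambda>\<omega>. \<omega> k))"
      by (rule nn_integral_distr[symmetric]) (auto intro!: measurable_component_singleton)
    also have "\<dots> = (\<integral>\<^sup>+x. ennreal (c k * x\<^sup>2) \<partial>?G)" by (subst std_normals.PiM_component) auto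
    also have "\<dots> = ennreal (c k) * (\<integral>\<^sup>+x. ennreal (x\<^sup>2) \<partial>?G)"
      using c(1) by (subst nn_integral_cmult[symmetric]) (auto simp: ennreal_mult)
    finally show ?thesis by (simp add: nn_integral_std_normal_sq)
  qed
  have "(\<integral>\<^sup>+\<omega>. (\<Sum>k. ennreal (c k * (\<omega> k)\<^sup>2)) \<partial>std_normals) =
      (\<Sum>k. \<integral>\<^sup>+\<omega>. ennreal (c k * (\<omega> k)\<^sup>2) \<partial>std_normals)"
    by (rule nn_integral_suminf) measurable
  also have "\<dots> = (\<Sum>k. ennreal (c k))" by (simp only: coord)
  also have "\<dots> = ennreal (\<Sum>k. c k)" by (rule suminf_ennreal2) (use c in auto)
  finally have "AE \<omega> in std_normals. fin \<omega>"
    unfolding fin_def by (intro nn_integral_noteq_infinite) (auto simp: top_unique)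
  have fin_sum: "summable (\<lambda>k. (sqrt (c k) * \<omega> k)\<^sup>2)" if "fin \<omega>" for \<omega>
  proof -
    have "summable (\<lambda>k. c k * (\<omega> k)\<^sup>2)"
      by (rule summable_suminf_not_top) (use that c in \<open>auto simp: fin_def\<close>)
    then show ?thesis using c(1) by (simp add: power_mult_distrib)
  qed
  \<comment> \<open>On the null set where the sum of squares is infinite the vector is
    \<open>0\<close>, which keeps every coordinate of \<open>X\<close> measurable.\<close>
  have "\<exists>x. \<forall>k. x \<bullet> e k = (if fin \<omega> then sqrt (c k) * \<omega> k else 0)" for \<omega>
  proof (cases "fin \<omega>")
    case True
    then show ?thesis using riesz_fischer_sums[OF fin_sum[OF True]] by metis
  qed (auto intro: exI[of _ 0])
  then obtain X where X: "\<And>\<omega> k. X \<omega> \<bullet> e k = (if fin \<omega> then sqrt (c k) * \<omega> k else 0)" by metis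
  have X_meas [measurable]: "X \<in> borel_measurable std_normals"
    by (rule borel_measurable_coordI) (unfold X, measurable)
  define \<nu> where "\<nu> = distr std_normals borel X"
  have "(LINT x|\<nu>. exp (\<i> * complex_of_real (\<xi> \<bullet> x))) =
      complex_of_real (exp (- (C \<xi> \<bullet> \<xi>) / 2))" for \<xi>
  proof -
    define a where "a k = sqrt (c k) * (\<xi> \<bullet> e k)" for k
    define s where "s n \<omega> = exp (\<i> * complex_of_real (\<Sum>k<n. a k * \<omega> k))" for n and \<omega> :: "nat \<Rightarrow> real"
    have "(\<lambda>n. LINT \<omega>|std_normals. s n \<omega>) \<longlonglongrightarrow>
        (LINT \<omega>|std_normals. exp (\<i> * complex_of_real (\<xi> \<bullet> X \<omega>)))"
    proof (rule integral_dominated_convergence[where w = "\<lambda>_. 1"])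
      show "(\<lambda>\<omega>. exp (\<i> * complex_of_real (\<xi> \<bullet> X \<omega>))) \<in> borel_measurable std_normals"
        by (rule measurable_compose[OF X_meas borel_measurable_exp_inner])
      show "s n \<in> borel_measurable std_normals" for n unfolding s_def by measurable
      show "AE \<omega> in std_normals. (\<lambda>n. s n \<omega>) \<longlonglongrightarrow> exp (\<i> * complex_of_real (\<xi> \<bullet> X \<omega>))"
        using \<open>AE \<omega> in std_normals. fin \<omega>\<close>
      proof eventually_elim
        case (elim \<omega>)
        have "(\<lambda>k. a k * \<omega> k) sums (\<xi> \<bullet> X \<omega>)"
          using parseval[of \<xi> "X \<omega>"] elim by (simp add: X a_def mult_ac)
        then show ?case unfolding s_def sums_def by (intro tendsto_intros)
      qed
      show "AE \<omega> in std_normals. norm (s n \<omega>) \<le> 1" for n by (simp add: s_def norm_exp_eq_Re)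
    qed simp
    moreover have "(\<lambda>n. LINT \<omega>|std_normals. s n \<omega>) \<longlonglongrightarrow> complex_of_real (exp (- (C \<xi> \<bullet> \<xi>) / 2))"
    proof -
      have "(a k)\<^sup>2 = c k * (\<xi> \<bullet> e k)\<^sup>2" for k using c(1) by (simp add: a_def power_mult_distrib)
      then have "(\<lambda>n. \<Sum>k<n. (a k)\<^sup>2) \<longlonglongrightarrow> C \<xi> \<bullet> \<xi>" using C[of \<xi>] by (simp add: sums_def)
      then show ?thesis unfolding s_def integral_std_normals_iexp by (intro tendsto_intros) auto
    qed
    ultimately have "(LINT \<omega>|std_normals. exp (\<i> * complex_of_real (\<xi> \<bullet> X \<omega>))) =
        complex_of_real (exp (- (C \<xi> \<bullet> \<xi>) / 2))" by (rule LIMSEQ_unique)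
    then show ?thesis unfolding \<nu>_def
      by (subst integral_distr[OF X_meas borel_measurable_exp_inner])
  qed
  moreover have "prob_space \<nu>" unfolding \<nu>_def by (rule std_normals.prob_space_distr) measurable
  ultimately have "centered_gaussian C \<nu>"
    unfolding centered_gaussian_def by (auto simp: \<nu>_def dest: prob_space.emeasure_space_1)
  then show ?thesis by blast
qed

section \<open>Integrating products of Gaussian weights\<close>

text \<open>Only the joint characteristic function of the first \<open>N\<close> coordinates is
  recorded, the common ground of the covariances tD and D_n: the former has it for every
  \<open>N\<close>, the latter for \<open>N = n\<close>, with deviations independent of
  \<open>n\<close>, although its remaining coordinates are degenerate.\<close>

definition gaussian_coords ::
    "(nat \<Rightarrow> 'a::real_inner) \<Rightarrow> (nat \<Rightarrow> real) \<Rightarrow> nat \<Rightarrow> 'a measure \<Rightarrow> bool" where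
  "gaussian_coords e \<sigma> N \<nu> \<longleftrightarrow> sets \<nu> = sets borel \<and> prob_space \<nu> \<and>
     (\<forall>y. (LINT x|\<nu>. exp (\<i> * complex_of_real (\<Sum>k<N. y k * (x \<bullet> e k)))) =
          complex_of_real (exp (- (\<Sum>k<N. (\<sigma> k * y k)\<^sup>2) / 2)))"

text \<open>Test vectors in the span of the first \<open>N\<close> basis vectors suffice, so
  \<open>\<sigma>\<close> has to match the diagonal \<open>c\<close> only below
  \<open>N\<close>.\<close>

lemma (in onb) gaussian_coordsI:
  assumes "centered_gaussian C \<nu>"
    and C: "\<And>\<xi>. (\<lambda>k. c k * (\<xi> \<bullet> e k)\<^sup>2) sums (C \<xi> \<bullet> \<xi>)"
    and \<sigma>: "\<And>k. k < N \<Longrightarrow> (\<sigma> k)\<^sup>2 = c k"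
  shows "gaussian_coords e \<sigma> N \<nu>"
  unfolding gaussian_coords_def
proof (intro conjI allI)
  show "sets \<nu> = sets borel" "prob_space \<nu>"
    using assms(1) by (auto simp: centered_gaussian_def intro: prob_spaceI)
  fix y
  define \<xi> where "\<xi> = (\<Sum>k<N. y k *\<^sub>R e k)"
  have coord: "\<xi> \<bullet> e k = (if k < N then y k else 0)" for k
    by (simp add: \<xi>_def inner_sum_basis)
  have "(\<lambda>k. c k * (\<xi> \<bullet> e k)\<^sup>2) sums (\<Sum>k<N. c k * (\<xi> \<bullet> e k)\<^sup>2)"
    by (rule sums_finite) (auto simp: coord)
  then have "C \<xi> \<bullet> \<xi> = (\<Sum>k<N. c k * (\<xi> \<bullet> e k)\<^sup>2)" using C[of \<xi>] by (rule sums_unique2[symmetric])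
  also have "\<dots> = (\<Sum>k<N. (\<sigma> k * y k)\<^sup>2)"
    by (rule sum.cong) (auto simp: coord \<sigma> power_mult_distrib)
  finally have "C \<xi> \<bullet> \<xi> = (\<Sum>k<N. (\<sigma> k * y k)\<^sup>2)" .
  moreover have "(\<Sum>k<N. y k * (x \<bullet> e k)) = \<xi> \<bullet> x" for x
    unfolding \<xi>_def inner_sum_left by (simp add: inner_commute)
  ultimately show "(LINT x|\<nu>. exp (\<i> * complex_of_real (\<Sum>k<N. y k * (x \<bullet> e k)))) =
      complex_of_real (exp (- (\<Sum>k<N. (\<sigma> k * y k)\<^sup>2) / 2))"
    using assms(1) by (simp add: centered_gaussian_def)
qed

lemma integral_std_normal_gauss:
  "(LINT x|std_normal_distribution. exp (- x\<^sup>2 / 2)) = 1 / sqrt 2"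
proof -
  \<comment> \<open>The exponents add up to that of variance \<open>1/2\<close>, and the normalising
    constants differ by the factor \<open>1 / sqrt 2\<close>, the constant of the later
    bounds.\<close>
  have "std_normal_density x * exp (- x\<^sup>2 / 2) = 1 / sqrt 2 * normal_density 0 (1 / sqrt 2) x" for x
    by (simp add: normal_density_def real_sqrt_mult power_divide mult_exp_exp)
  then have "(LINT x|std_normal_distribution. exp (- x\<^sup>2 / 2)) =
      (LINT x|lborel. 1 / sqrt 2 * normal_density 0 (1 / sqrt 2) x)"
    by (subst integral_density) auto
  also have "\<dots> = 1 / sqrt 2 * (LINT x|lborel. normal_density 0 (1 / sqrt 2) x)"
    by (rule integral_mult_right_zero)
  also have "(LINT x|lborel. normal_density 0 (1 / sqrt 2) x) = 1"
    by (rule integral_normal_density) simp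
  finally show ?thesis by simp
qed

text \<open>Each weight is a mixture of characters: the Gaussian factor is the Fourier transform of the
  standard normal distribution. Peeling off one weight at a time by Fubini, only the characteristic
  function of \<open>\<nu>\<close> is used, so no uniqueness theorem for multivariate characteristic functions
  is needed.\<close>

lemma gaussian_coords_integral_prod:
  fixes e :: "nat \<Rightarrow> 'a::real_inner" and \<alpha> \<beta> s :: "nat \<Rightarrow> real"
  assumes gc: "gaussian_coords e \<sigma> N \<nu>" and \<sigma>: "\<And>k. k < N \<Longrightarrow> \<sigma> k > 0"
  defines "w \<equiv> \<lambda>k z. \<alpha> k + \<beta> k * exp (- ((z - s k) / \<sigma> k)\<^sup>2 / 2)"
  defines "m \<equiv> \<lambda>k. complex_of_real (\<alpha> k) + complex_of_real (\<beta> k) *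
     (LINT \<xi>|std_normal_distribution.
        exp (\<i> * complex_of_real (- \<xi> * s k / \<sigma> k)) * complex_of_real (exp (- \<xi>\<^sup>2 / 2)))"
  assumes "n \<le> N"
  shows "(LINT x|\<nu>. complex_of_real (\<Prod>k<n. w k (x \<bullet> e k)) *
            exp (\<i> * complex_of_real (\<Sum>k=n..<N. y k * (x \<bullet> e k)))) =
         (\<Prod>k<n. m k) * complex_of_real (exp (- (\<Sum>k=n..<N. (\<sigma> k * y k)\<^sup>2) / 2))"
  using \<open>n \<le> N\<close>
proof (induction n arbitrary: y)
  case 0
  then show ?case using gc by (simp add: gaussian_coords_def lessThan_atLeast0)
next
  case (Suc n)
  let ?G = "std_normal_distribution"
  have sets_\<nu>: "sets \<nu> = sets borel" using gc by (simp add: gaussian_coords_def)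
  interpret \<nu>: prob_space \<nu> using gc by (simp add: gaussian_coords_def)
  interpret G: prob_space ?G by (simp add: prob_space_normal_density)
  interpret pair_prob_space \<nu> ?G ..
  have [measurable]: "(\<lambda>x. x \<bullet> e k) \<in> borel_measurable \<nu>" for k
    unfolding measurable_cong_sets[OF sets_\<nu> refl]
    by (intro borel_measurable_continuous_onI continuous_intros)
  have [measurable]: "w k \<in> borel_measurable borel" for k unfolding w_def by measurable
  define A where "A x = (\<Prod>k<n. w k (x \<bullet> e k))" for x
  \<comment> \<open>The induction is over all frequencies \<open>y\<close>, so that slot
    \<open>n\<close> can receive the frequency which the mixture for weight \<open>n\<close> calls
    for.\<close>
  define Y where "Y z = y(n := z)" for z
  define F where "F z x = exp (\<i> * complex_of_real (\<Sum>k=n..<N. Y z k * (x \<bullet> e k)))" for z x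
  define I where "I z = exp (- (\<Sum>k=n..<N. (\<sigma> k * Y z k)\<^sup>2) / 2)" for z
  have IH: "(LINT x|\<nu>. complex_of_real (A x) * F z x) = (\<Prod>k<n. m k) * complex_of_real (I z)" for z
    using Suc.IH[of "Y z"] Suc.prems by (simp add: A_def F_def I_def)
  have [measurable]: "A \<in> borel_measurable \<nu>" unfolding A_def by measurable
  have split: "(\<Sum>k=n..<N. g k) = g n + (\<Sum>k=Suc n..<N. g k)" for g :: "nat \<Rightarrow> real"
    using Suc.prems by (simp add: sum.atLeast_Suc_lessThan)
  have F_split: "F z x = exp (\<i> * complex_of_real (z * (x \<bullet> e n))) * F 0 x" for z x
    by (simp add: F_def split Y_def distrib_left exp_add)
  have I_split: "I z = exp (- (\<sigma> n * z)\<^sup>2 / 2) * I 0" for z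
  proof -
    let ?S = "\<Sum>k=Suc n..<N. (\<sigma> k * y k)\<^sup>2"
    have "I z = exp (- ((\<sigma> n * z)\<^sup>2 + ?S) / 2)" "I 0 = exp (- ?S / 2)"
      by (simp_all add: I_def split Y_def)
    moreover have "- ((\<sigma> n * z)\<^sup>2 + ?S) / 2 = - (\<sigma> n * z)\<^sup>2 / 2 + - ?S / 2"
      by (simp add: field_simps)
    ultimately show ?thesis by (simp only: exp_add)
  qed
  have F0: "F 0 x = exp (\<i> * complex_of_real (\<Sum>k=Suc n..<N. y k * (x \<bullet> e k)))" for x
    by (simp add: F_def split Y_def)
  have I0: "I 0 = exp (- (\<Sum>k=Suc n..<N. (\<sigma> k * y k)\<^sup>2) / 2)"
    by (simp add: I_def split Y_def)
  have [measurable]: "F z \<in> borel_measurable \<nu>" for z unfolding F_def by measurable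
  have normF: "cmod (F z x) = 1" for z x by (simp add: F_def)
  define B where "B = (\<Prod>k<n. \<bar>\<alpha> k\<bar> + \<bar>\<beta> k\<bar>)"
  have A_le: "\<bar>A x\<bar> \<le> B" for x
    unfolding A_def B_def abs_prod
  proof (rule prod_mono)
    fix k
    have "\<bar>w k z\<bar> \<le> \<bar>\<alpha> k\<bar> + \<bar>\<beta> k\<bar> * 1" for z
      unfolding w_def by (rule order.trans[OF abs_triangle_ineq])
        (auto simp: abs_mult intro!: mult_left_le)
    then show "0 \<le> \<bar>w k (x \<bullet> e k)\<bar> \<and> \<bar>w k (x \<bullet> e k)\<bar> \<le> \<bar>\<alpha> k\<bar> + \<bar>\<beta> k\<bar>" by simp
  qed
  \<comment> \<open>Integrating \<open>K\<close> over the mixing frequency \<open>\<xi>\<close>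
    gives back the Gaussian factor of weight \<open>n\<close>. Integrating over \<open>x\<close>
    with \<open>\<xi>\<close> fixed meets a character of frequency \<open>\<xi> / \<sigma> n\<close>
    in slot \<open>n\<close>, to which the induction hypothesis applies.\<close>
  define K where "K \<xi> x = complex_of_real (A x) * F 0 x *
      exp (\<i> * complex_of_real (\<xi> * ((x \<bullet> e n - s n) / \<sigma> n)))" for \<xi> x
  have K_le: "cmod (K \<xi> x) \<le> B" for \<xi> x
    using A_le[of x] by (simp add: K_def norm_mult normF)
  have K_int: "integrable (\<nu> \<Otimes>\<^sub>M ?G) (\<lambda>(x, \<xi>). K \<xi> x)"
    by (rule P.integrable_const_bound[of _ B]) (use K_le in \<open>auto simp: K_def split_beta'\<close>)
  have K_split: "K \<xi> x = exp (\<i> * complex_of_real (- \<xi> * s n / \<sigma> n)) *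
      (complex_of_real (A x) * F (\<xi> / \<sigma> n) x)" for \<xi> x
    unfolding K_def F_split[of "\<xi> / \<sigma> n"]
    by (simp add: mult_exp_exp[symmetric] diff_divide_distrib right_diff_distrib exp_diff exp_minus divide_inverse mult_ac)
  have int0: "integrable \<nu> (\<lambda>x. complex_of_real (A x) * F 0 x)"
    by (rule \<nu>.integrable_const_bound[of _ B]) (use A_le in \<open>auto simp: norm_mult normF\<close>)
  have "(LINT x|\<nu>. LINT \<xi>|?G. K \<xi> x) = (LINT \<xi>|?G. LINT x|\<nu>. K \<xi> x)"
    by (rule Fubini_integral[symmetric]) (rule K_int)
  also have "\<dots> = (LINT \<xi>|?G. exp (\<i> * complex_of_real (- \<xi> * s n / \<sigma> n)) *
      ((\<Prod>k<n. m k) * complex_of_real (exp (- \<xi>\<^sup>2 / 2) * I 0)))"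
    unfolding K_split integral_mult_right_zero IH I_split[of "_ / \<sigma> n"]
    using \<sigma>[of n] Suc.prems by simp
  also have "\<dots> = (LINT \<xi>|?G. ((\<Prod>k<n. m k) * complex_of_real (I 0)) *
      (exp (\<i> * complex_of_real (- \<xi> * s n / \<sigma> n)) * complex_of_real (exp (- \<xi>\<^sup>2 / 2))))"
    by (rule Bochner_Integration.integral_cong) (simp_all add: mult_ac)
  finally have K_eq: "(LINT x|\<nu>. LINT \<xi>|?G. K \<xi> x) = (\<Prod>k<n. m k) * complex_of_real (I 0) *
      (LINT \<xi>|?G. exp (\<i> * complex_of_real (- \<xi> * s n / \<sigma> n)) * complex_of_real (exp (- \<xi>\<^sup>2 / 2)))"
    unfolding integral_mult_right_zero .
  have K_inner: "(LINT \<xi>|?G. K \<xi> x) =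
      complex_of_real (A x) * F 0 x * complex_of_real (exp (- ((x \<bullet> e n - s n) / \<sigma> n)\<^sup>2 / 2))" for x
    unfolding K_def integral_mult_right_zero
    using integral_std_normal_iexp[of "(x \<bullet> e n - s n) / \<sigma> n"] by (simp add: mult.commute)
  have "(LINT x|\<nu>. complex_of_real (\<Prod>k<Suc n. w k (x \<bullet> e k)) *
      exp (\<i> * complex_of_real (\<Sum>k=Suc n..<N. y k * (x \<bullet> e k)))) =
      (LINT x|\<nu>. complex_of_real (\<alpha> n) * (complex_of_real (A x) * F 0 x) +
         complex_of_real (\<beta> n) * (LINT \<xi>|?G. K \<xi> x))"
  proof (rule Bochner_Integration.integral_cong)
    fix x
    have "complex_of_real (\<Prod>k<Suc n. w k (x \<bullet> e k)) = complex_of_real (A x) *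
        (complex_of_real (\<alpha> n) + complex_of_real (\<beta> n) *
          complex_of_real (exp (- ((x \<bullet> e n - s n) / \<sigma> n)\<^sup>2 / 2)))"
      by (simp add: A_def w_def)
    then show "complex_of_real (\<Prod>k<Suc n. w k (x \<bullet> e k)) *
        exp (\<i> * complex_of_real (\<Sum>k=Suc n..<N. y k * (x \<bullet> e k))) =
        complex_of_real (\<alpha> n) * (complex_of_real (A x) * F 0 x) +
        complex_of_real (\<beta> n) * (LINT \<xi>|?G. K \<xi> x)"
      unfolding K_inner F0[symmetric] by (simp only:) (simp only: algebra_simps)
  qed simp
  also have "\<dots> = complex_of_real (\<alpha> n) * (LINT x|\<nu>. complex_of_real (A x) * F 0 x) +
      complex_of_real (\<beta> n) * (LINT x|\<nu>. LINT \<xi>|?G. K \<xi> x)"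
    using int0 integrable_fst'[OF K_int] by simp
  also have "\<dots> = (\<Prod>k<Suc n. m k) * complex_of_real (I 0)"
    unfolding IH K_eq by (simp add: m_def algebra_simps)
  finally show ?case by (simp only: I0)
qed

text \<open>The centre \<open>s k\<close> enters the factor \<open>m k\<close> only through a phase
  inside the mixing integral, and absolute values remove it. This is the source of the uniformity in
  the centres.\<close>

lemma gaussian_coords_integral_prod_le:
  fixes e :: "nat \<Rightarrow> 'a::real_inner" and \<beta> s :: "nat \<Rightarrow> real"
  assumes gc: "gaussian_coords e \<sigma> N \<nu>" and \<sigma>: "\<And>k. k < N \<Longrightarrow> \<sigma> k > 0"
    and \<beta>: "\<And>k. k < N \<Longrightarrow> 0 \<le> \<beta> k \<and> \<beta> k \<le> 1"
  shows "(LINT x|\<nu>. (\<Prod>k<N. 1 - \<beta> k * (1 - exp (- ((x \<bullet> e k - s k) / \<sigma> k)\<^sup>2 / 2)))) \<le>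
         (\<Prod>k<N. 1 - \<beta> k * (1 - 1 / sqrt 2))"
proof -
  let ?G = "std_normal_distribution"
  define m where "m k = complex_of_real (1 - \<beta> k) + complex_of_real (\<beta> k) *
     (LINT \<xi>|?G. exp (\<i> * complex_of_real (- \<xi> * s k / \<sigma> k)) * complex_of_real (exp (- \<xi>\<^sup>2 / 2)))" for k
  define I where "I = (LINT x|\<nu>. (\<Prod>k<N. 1 - \<beta> k * (1 - exp (- ((x \<bullet> e k - s k) / \<sigma> k)\<^sup>2 / 2))))"
  have m_le: "cmod (m k) \<le> 1 - \<beta> k * (1 - 1 / sqrt 2)" if "k < N" for k
  proof -
    let ?E = "LINT \<xi>|?G. exp (\<i> * complex_of_real (- \<xi> * s k / \<sigma> k)) * complex_of_real (exp (- \<xi>\<^sup>2 / 2))"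
    have "cmod ?E \<le> (LINT \<xi>|?G. cmod (exp (\<i> * complex_of_real (- \<xi> * s k / \<sigma> k)) * complex_of_real (exp (- \<xi>\<^sup>2 / 2))))"
      by (rule integral_norm_bound)
    also have "\<dots> = 1 / sqrt 2" unfolding norm_mult integral_std_normal_gauss[symmetric] by simp
    finally have "\<beta> k * cmod ?E \<le> \<beta> k * (1 / sqrt 2)" using \<beta>[OF that] by (intro mult_left_mono) auto
    moreover have "cmod (m k) \<le> (1 - \<beta> k) + \<beta> k * cmod ?E"
      unfolding m_def using \<beta>[OF that]
      by (intro order.trans[OF norm_triangle_ineq]) (simp add: norm_mult del: of_real_diff)
    ultimately show ?thesis by (simp add: algebra_simps)
  qed
  have "complex_of_real I = (LINT x|\<nu>. complex_of_real (\<Prod>k<N. (1 - \<beta> k) + \<beta> k * exp (- ((x \<bullet> e k - s k) / \<sigma> k)\<^sup>2 / 2)))"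
    unfolding I_def integral_complex_of_real by (simp add: algebra_simps)
  also have "\<dots> = (\<Prod>k<N. m k)"
    using gaussian_coords_integral_prod[OF gc \<sigma> order_refl, of "\<lambda>k. 1 - \<beta> k" \<beta> s "\<lambda>_. 0"]
    by (simp add: m_def)
  finally have "I \<le> cmod (\<Prod>k<N. m k)" by (metis norm_of_real abs_ge_self)
  also have "\<dots> \<le> (\<Prod>k<N. 1 - \<beta> k * (1 - 1 / sqrt 2))"
    unfolding prod_norm[symmetric] by (rule prod_mono) (use m_le in auto)
  finally show ?thesis by (simp add: I_def)
qed

section \<open>Blocks and their intersections\<close>

text \<open>Ensures that the \<open>lim\<close> in the definition of the measure is a genuine limit.
  Factors above \<open>1\<close> have a convergent product by summability of their logarithms,
  factors below \<open>1\<close> have decreasing partial products; the limit \<open>0\<close> is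
  allowed.\<close>

lemma convergent_prod_pos_part:
  fixes l :: "nat \<Rightarrow> real"
  assumes l: "\<And>j. l j > 0" and s: "summable (\<lambda>j. max 0 (ln (l j)))"
  shows "convergent (\<lambda>n. \<Prod>j<n. l j)"
proof -
  have exp_eq: "exp (max 0 (ln (l j))) = max 1 (l j)" for j
    using l[of j] by (cases "l j \<ge> 1") (auto simp: max_def not_le)
  have "(\<lambda>n. exp (\<Sum>j<n. max 0 (ln (l j)))) \<longlonglongrightarrow> exp (\<Sum>j. max 0 (ln (l j)))"
    by (intro tendsto_exp summable_LIMSEQ s)
  then have "convergent (\<lambda>n. \<Prod>j<n. max 1 (l j))"
    by (auto simp: exp_sum exp_eq convergent_def)
  moreover have "convergent (\<lambda>n. \<Prod>j<n. min 1 (l j))"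
  proof (rule Bseq_monoseq_convergent)
    have nn: "0 \<le> (\<Prod>j<n. min 1 (l j))" for n using l by (auto intro!: prod_nonneg simp: less_imp_le)
    have le: "(\<Prod>j<n. min 1 (l j)) \<le> 1" for n using l by (auto intro!: prod_le_1 simp: less_imp_le)
    show "Bseq (\<lambda>n. \<Prod>j<n. min 1 (l j))" using nn le by (auto intro!: BseqI'[of _ 1])
    show "monoseq (\<lambda>n. \<Prod>j<n. min 1 (l j))"
      by (intro decseq_imp_monoseq decseq_SucI) (use nn in \<open>simp add: mult_left_le\<close>)
  qed
  ultimately have "convergent (\<lambda>n. (\<Prod>j<n. max 1 (l j)) * (\<Prod>j<n. min 1 (l j)))"
    by (rule convergent_mult)
  moreover have "max 1 x * min 1 x = x" for x :: real by (simp add: max_def min_def)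
  ultimately show ?thesis by (simp add: prod.distrib[symmetric])
qed

text \<open>Every factor is at least \<open>1\<close>, so no finite subproduct exceeds the full one.
  An infinite \<open>A\<close> has the default product \<open>1\<close>, which is within the bound
  too.\<close>

lemma prod_max_1_le_exp:
  fixes l :: "nat \<Rightarrow> real"
  assumes l: "\<And>j. l j > 0" and s: "summable (\<lambda>j. max 0 (ln (l j)))"
  shows "(\<Prod>j\<in>A. max 1 (l j)) \<le> exp (\<Sum>j. max 0 (ln (l j)))"
proof (cases "finite A")
  case True
  have "exp (max 0 (ln (l j))) = max 1 (l j)" for j
    using l[of j] by (cases "l j \<ge> 1") (auto simp: max_def not_le)
  then have "(\<Prod>j\<in>A. max 1 (l j)) = exp (\<Sum>j\<in>A. max 0 (ln (l j)))" using True by (simp add: exp_sum)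
  also have "\<dots> \<le> exp (\<Sum>j. max 0 (ln (l j)))" using True s by (simp add: sum_le_suminf)
  finally show ?thesis .
qed (simp add: suminf_nonneg s)

lemma prod_one_minus_LIMSEQ_0:
  fixes x :: "nat \<Rightarrow> real"
  assumes x: "\<And>k. 0 \<le> x k" "\<And>k. x k \<le> 1" and ns: "\<not> summable x"
  shows "(\<lambda>n. \<Prod>k<n. 1 - x k) \<longlonglongrightarrow> 0"
proof (rule tendsto_sandwich[of "\<lambda>_. 0" _ _ "\<lambda>n. exp (- (\<Sum>k<n. x k))"])
  have "(\<Prod>k<n. 1 - x k) \<le> exp (- (\<Sum>k<n. x k))" for n
    unfolding sum_negf[symmetric] exp_sum[OF finite_lessThan]
    by (rule prod_mono) (use x exp_ge_add_one_self[of "- x _"] in auto)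
  then show "\<forall>\<^sub>F n in sequentially. (\<Prod>k<n. 1 - x k) \<le> exp (- (\<Sum>k<n. x k))" by simp
  show "\<forall>\<^sub>F n in sequentially. 0 \<le> (\<Prod>k<n. 1 - x k)" using x by (simp add: prod_nonneg)
  have "filterlim (\<lambda>n. \<Sum>k<n. x k) at_top sequentially"
    unfolding filterlim_at_top
  proof
    fix Z
    obtain N where N: "Z \<le> (\<Sum>k<N. x k)"
      using summableI_nonneg_bounded[of x Z] x(1) ns by (meson linear)
    have "Z \<le> (\<Sum>k<n. x k)" if "n \<ge> N" for n
      using N sum_mono2[of "{..<n}" "{..<N}" x] that x(1) by fastforce
    then show "\<forall>\<^sub>F n in sequentially. Z \<le> (\<Sum>k<n. x k)"
      unfolding eventually_sequentially by blast
  qed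
  then show "(\<lambda>n. exp (- (\<Sum>k<n. x k))) \<longlonglongrightarrow> 0"
    by (intro filterlim_compose[OF exp_at_bot] filterlim_compose[OF filterlim_uminus_at_bot_at_top])
qed simp

text \<open>Lets a linear loss of overlap be replaced by the Gaussian profile, which is quadratic
  near \<open>0\<close> and never exceeds \<open>1\<close>.\<close>

lemma one_minus_exp_le_abs: "1 - exp (- x\<^sup>2 / 2) \<le> \<bar>x\<bar>" for x :: real
proof (cases "\<bar>x\<bar> \<le> 1")
  case True
  have "1 - exp (- x\<^sup>2 / 2) \<le> x\<^sup>2 / 2" using exp_ge_add_one_self[of "- x\<^sup>2 / 2"] by simp
  also have "\<dots> \<le> \<bar>x\<bar>\<^sup>2" by simp
  also have "\<dots> = \<bar>x\<bar> * \<bar>x\<bar>" by (rule power2_eq_square)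
  also have "\<dots> \<le> \<bar>x\<bar>" using True by (intro mult_left_le) auto
  finally show ?thesis .
next
  case False
  then show ?thesis using exp_gt_zero[of "- x\<^sup>2 / 2"] by linarith
qed

text \<open>\<open>s\<close> is the displacement \<open>u\<close> at which the midpoints coincide,
  and the overlap is at most the mean length less \<open>\<bar>u - s\<bar>\<close>. \<Lambda>
  dominates both lengths and is a product of factors at least \<open>1\<close>, so that its product
  over all coordinates can be bounded. \<open>\<kappa> * \<Lambda> \<le> 1\<close> turns the
  absolute loss into a factor, and \<open>\<kappa> * \<sigma> \<le> 1\<close> keeps that factor
  nonnegative.\<close>

lemma interval_overlap_le:
  fixes a b a' b' u v \<sigma> \<kappa> :: real
  defines "\<Lambda> \<equiv> max 1 (b - a) * max 1 (b' - a')"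
    and "s \<equiv> v + (a' + b' - a - b) / 2"
  assumes \<sigma>: "\<sigma> > 0" "\<kappa> * \<sigma> \<le> 1" and \<kappa>: "\<kappa> > 0" "\<kappa> * \<Lambda> \<le> 1"
  shows "max 0 (min (b + u) (b' + v) - max (a + u) (a' + v)) \<le>
     \<Lambda> * (1 - \<kappa> * \<sigma> * (1 - exp (- ((u - s) / \<sigma>)\<^sup>2 / 2)))"
proof -
  have \<Lambda>: "b - a \<le> \<Lambda>" "b' - a' \<le> \<Lambda>" "1 \<le> \<Lambda>"
  proof -
    have "max 1 (b - a) * 1 \<le> \<Lambda>" "1 * max 1 (b' - a') \<le> \<Lambda>"
      unfolding \<Lambda>_def by (intro mult_mono; simp)+
    then show "b - a \<le> \<Lambda>" "b' - a' \<le> \<Lambda>" "1 \<le> \<Lambda>" by auto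
  qed
  have ov: "min (b + u) (b' + v) - max (a + u) (a' + v) \<le> \<Lambda> - \<bar>u - s\<bar>"
  proof -
    define L where "L = min (b + u) (b' + v) - max (a + u) (a' + v)"
    have "L \<le> (b + u) - (a' + v)" "L \<le> (b' + v) - (a + u)"
      unfolding L_def by (intro diff_mono; simp)+
    moreover have "(b + u) - (a' + v) = ((b - a) + (b' - a')) / 2 + (u - s)"
      "(b' + v) - (a + u) = ((b - a) + (b' - a')) / 2 - (u - s)"
      unfolding s_def by (simp_all add: field_simps)
    ultimately have "L \<le> \<Lambda> - \<bar>u - s\<bar>" using \<Lambda>(1,2) by linarith
    then show ?thesis by (simp only: L_def)
  qed
  define q where "q = 1 - exp (- ((u - s) / \<sigma>)\<^sup>2 / 2)"
  have q: "0 \<le> q" "q \<le> 1" "q \<le> \<bar>u - s\<bar> / \<sigma>"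
    using one_minus_exp_le_abs[of "(u - s) / \<sigma>"] \<sigma> by (simp_all add: q_def abs_divide)
  have "\<kappa> * \<sigma> * q \<le> \<kappa> * \<bar>u - s\<bar>"
    using q(3) \<sigma> \<kappa> by (simp add: field_simps)
  then have "\<Lambda> * (\<kappa> * \<sigma> * q) \<le> \<Lambda> * (\<kappa> * \<bar>u - s\<bar>)" using \<Lambda> by (intro mult_left_mono) auto
  also have "\<dots> = (\<kappa> * \<Lambda>) * \<bar>u - s\<bar>" by simp
  also have "\<dots> \<le> 1 * \<bar>u - s\<bar>" using \<kappa> by (intro mult_right_mono) auto
  finally have "\<Lambda> - \<bar>u - s\<bar> \<le> \<Lambda> * (1 - \<kappa> * \<sigma> * q)" by (simp add: right_diff_distrib)
  moreover have "0 \<le> \<Lambda> * (1 - \<kappa> * \<sigma> * q)"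
    using \<Lambda> mult_mono[OF \<sigma>(2) q(2)] q(1) by (intro mult_nonneg_nonneg) auto
  ultimately show ?thesis using ov by (simp add: q_def)
qed

section \<open>Translates and intersections of blocks, and the ring they generate\<close>

context onb begin

text \<open>Singles out the nonempty blocks, for which the summability condition is in force and the
  product formula for the measure applies.\<close>

definition abs_measurable_bounds :: "(nat \<Rightarrow> real) \<Rightarrow> (nat \<Rightarrow> real) \<Rightarrow> bool" where
  "abs_measurable_bounds a b \<longleftrightarrow> block_bounds a b \<and> block e a b \<noteq> {} \<and>
     summable (\<lambda>j. max 0 (ln (b j - a j)))"

lemma abs_measurable_boundsD:
  assumes "abs_measurable_bounds a b"
  shows "a j < b j" "block e a b \<noteq> {}" "summable (\<lambda>j. max 0 (ln (b j - a j)))"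
    "block e a b \<in> abs_measurable_blocks e"
  using assms by (auto simp: abs_measurable_bounds_def block_bounds_def abs_measurable_blocks_def)

lemma abs_measurable_blocks_cases:
  assumes "B \<in> abs_measurable_blocks e" "B \<noteq> {}"
  obtains a b where "abs_measurable_bounds a b" "B = block e a b"
  using assms by (auto simp: abs_measurable_bounds_def abs_measurable_blocks_def)

lemma block_translate:
  "(+) h ` block e a b = block e (\<lambda>j. a j + h \<bullet> e j) (\<lambda>j. b j + h \<bullet> e j)"
proof (intro equalityI subsetI)
  fix x assume "x \<in> block e (\<lambda>j. a j + h \<bullet> e j) (\<lambda>j. b j + h \<bullet> e j)"
  then have "x - h \<in> block e a b" by (simp add: block_def inner_diff_left algebra_simps)
  then show "x \<in> (+) h ` block e a b" by (intro image_eqI[of _ _ "x - h"]) auto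
qed (auto simp: block_def inner_add_left)

lemma block_Int: "block e a b \<inter> block e a' b' =
    block e (\<lambda>j. max (a j) (a' j)) (\<lambda>j. min (b j) (b' j))"
  by (auto simp: block_def)

lemma block_bounds_translate:
  assumes "block_bounds a b"
  shows "block_bounds (\<lambda>j. a j + h \<bullet> e j) (\<lambda>j. b j + h \<bullet> e j)"
proof -
  have "bounded (range (\<lambda>j. c j + h \<bullet> e j))" if c: "bounded (range c)" for c :: "nat \<Rightarrow> real"
  proof -
    have "bounded (range (\<lambda>j. h \<bullet> e j))"
      by (rule boundedI[of _ "norm h"]) (use abs_coord_le in auto)
    then show ?thesis using c by (intro bounded_plus_comp)
  qed
  then show ?thesis using assms by (simp add: block_bounds_def)
qed

lemma translate_abs_measurable_blocks:
  assumes "B \<in> abs_measurable_blocks e"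
  shows "(+) h ` B \<in> abs_measurable_blocks e"
proof -
  obtain a b where B: "B = block e a b" "block_bounds a b"
    "B = {} \<or> summable (\<lambda>j. max 0 (ln (b j - a j)))"
    using assms by (auto simp: abs_measurable_blocks_def)
  then show ?thesis
    unfolding abs_measurable_blocks_def mem_Collect_eq
    by (intro exI[of _ "\<lambda>j. a j + h \<bullet> e j"] exI[of _ "\<lambda>j. b j + h \<bullet> e j"])
      (auto simp: block_translate[symmetric] block_bounds_translate)
qed

lemma abs_measurable_bounds_translate:
  "abs_measurable_bounds a b \<Longrightarrow> abs_measurable_bounds (\<lambda>j. a j + h \<bullet> e j) (\<lambda>j. b j + h \<bullet> e j)"
  by (simp add: abs_measurable_bounds_def block_bounds_translate block_translate[symmetric])

text \<open>If \<open>x\<close> and \<open>y\<close> lie in the two blocks, then the point with coordinates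
  \<open>max (max a a') (min x y)\<close> lies in both, and its coordinates are bounded by those of \<open>x\<close> and \<open>y\<close>.\<close>

lemma abs_measurable_bounds_Int:
  assumes B: "abs_measurable_bounds a b" and B': "abs_measurable_bounds a' b'"
    and lt: "\<And>j. max (a j) (a' j) < min (b j) (b' j)"
  shows "abs_measurable_bounds (\<lambda>j. max (a j) (a' j)) (\<lambda>j. min (b j) (b' j))"
proof -
  obtain x y where x: "x \<in> block e a b" and y: "y \<in> block e a' b'"
    using B B' by (auto simp: abs_measurable_bounds_def)
  define z where "z j = max (max (a j) (a' j)) (min (x \<bullet> e j) (y \<bullet> e j))" for j
  have xy: "a j \<le> x \<bullet> e j" "x \<bullet> e j < b j" "a' j \<le> y \<bullet> e j" "y \<bullet> e j < b' j" for j
    using x y by (auto simp: block_def)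
  have z: "max (a j) (a' j) \<le> z j" "z j < min (b j) (b' j)" for j
    using lt[of j] xy[of j] by (auto simp: z_def)
  have z_sq: "(z j)\<^sup>2 \<le> (x \<bullet> e j)\<^sup>2 + (y \<bullet> e j)\<^sup>2" for j
  proof -
    have "z j \<le> max (x \<bullet> e j) (y \<bullet> e j)" "min (x \<bullet> e j) (y \<bullet> e j) \<le> z j"
      using xy[of j] by (auto simp: z_def)
    then have "\<bar>z j\<bar> \<le> \<bar>x \<bullet> e j\<bar> \<or> \<bar>z j\<bar> \<le> \<bar>y \<bullet> e j\<bar>" by linarith
    then have "(z j)\<^sup>2 \<le> (x \<bullet> e j)\<^sup>2 \<or> (z j)\<^sup>2 \<le> (y \<bullet> e j)\<^sup>2" by (simp add: abs_le_square_iff)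
    then show ?thesis by (smt (verit) zero_le_power2)
  qed
  have "summable (\<lambda>j. (z j)\<^sup>2)"
    by (rule summable_comparison_test'[OF summable_add[OF parseval_norm[THEN sums_summable, of x]
            parseval_norm[THEN sums_summable, of y]]]) (use z_sq in auto)
  then obtain w where "\<And>j. w \<bullet> e j = z j" by (metis riesz_fischer_sums)
  then have "w \<in> block e (\<lambda>j. max (a j) (a' j)) (\<lambda>j. min (b j) (b' j))"
    using z by (simp add: block_def)
  moreover have "block_bounds (\<lambda>j. max (a j) (a' j)) (\<lambda>j. min (b j) (b' j))"
  proof -
    have "bounded (range (\<lambda>j. max (c j) (d j))) \<and> bounded (range (\<lambda>j. min (c j) (d j)))"
      if "bounded (range c)" "bounded (range d)" for c d :: "nat \<Rightarrow> real"
    proof -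
      have "bounded (range c \<union> range d)" using that by simp
      moreover have "range (\<lambda>j. max (c j) (d j)) \<subseteq> range c \<union> range d"
        "range (\<lambda>j. min (c j) (d j)) \<subseteq> range c \<union> range d" by (auto simp: max_def min_def)
      ultimately show ?thesis by (meson bounded_subset)
    qed
    then show ?thesis using B B' lt by (simp add: abs_measurable_bounds_def block_bounds_def)
  qed
  moreover have "summable (\<lambda>j. max 0 (ln (min (b j) (b' j) - max (a j) (a' j))))"
  proof (rule summable_comparison_test'[OF abs_measurable_boundsD(3)[OF B], of 0])
    fix j
    have "ln (min (b j) (b' j) - max (a j) (a' j)) \<le> ln (b j - a j)"
      using lt[of j] by (intro ln_mono) auto
    then show "norm (max 0 (ln (min (b j) (b' j) - max (a j) (a' j)))) \<le> max 0 (ln (b j - a j))"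
      by auto
  qed
  ultimately show ?thesis by (auto simp: abs_measurable_bounds_def)
qed

lemma ring_of_sets_block_ring: "ring_of_sets UNIV (block_ring e)"
  unfolding block_ring_def by (rule hull_in) (auto simp: ring_of_sets_iff)

lemma block_ring_closed:
  shows block_ring_empty: "{} \<in> block_ring e"
    and block_ring_Un: "A \<in> block_ring e \<Longrightarrow> B \<in> block_ring e \<Longrightarrow> A \<union> B \<in> block_ring e"
    and block_ring_Diff: "A \<in> block_ring e \<Longrightarrow> B \<in> block_ring e \<Longrightarrow> A - B \<in> block_ring e"
    and block_ring_Int: "A \<in> block_ring e \<Longrightarrow> B \<in> block_ring e \<Longrightarrow> A \<inter> B \<in> block_ring e"
proof -
  interpret ring_of_sets UNIV "block_ring e" by (rule ring_of_sets_block_ring)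
  show "{} \<in> block_ring e" by (rule empty_sets)
  assume AB: "A \<in> block_ring e" "B \<in> block_ring e"
  show "A \<union> B \<in> block_ring e" "A - B \<in> block_ring e" "A \<inter> B \<in> block_ring e"
    using AB by (rule Un Diff Int)+
qed

lemma abs_measurable_block_in_ring: "B \<in> abs_measurable_blocks e \<Longrightarrow> B \<in> block_ring e"
  unfolding block_ring_def by (rule hull_inc)

text \<open>The sets whose translate by \<open>h\<close> lies in the ring themselves form a ring
  containing the blocks.\<close>

lemma translate_block_ring: "A \<in> block_ring e \<Longrightarrow> (+) h ` A \<in> block_ring e"
proof -
  assume A: "A \<in> block_ring e"
  have "ring_of_sets UNIV {A. (+) h ` A \<in> block_ring e}"
    unfolding ring_of_sets_iff
    by (auto simp: image_Un image_set_diff block_ring_empty block_ring_Un block_ring_Diff)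
  then show ?thesis
    using A translate_abs_measurable_blocks abs_measurable_block_in_ring
    unfolding block_ring_def[of e] by (elim hull_induct) (auto simp: block_ring_def[symmetric])
qed

end

section \<open>The measure of intersections of translated blocks and its Gaussian mean\<close>

locale shift_measure = onb e for e :: "nat \<Rightarrow> 'a::{real_inner, complete_space}" +
  fixes \<mu> :: "'a set \<Rightarrow> real"
  assumes shift_invariant: "shift_invariant_measure e \<mu>"
begin

lemma \<mu>_nonneg: "A \<in> block_ring e \<Longrightarrow> 0 \<le> \<mu> A"
  and \<mu>_Un_disjoint: "A \<in> block_ring e \<Longrightarrow> B \<in> block_ring e \<Longrightarrow> A \<inter> B = {} \<Longrightarrow> \<mu> (A \<union> B) = \<mu> A + \<mu> B"
  and \<mu>_empty: "\<mu> {} = 0"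
  and \<mu>_translate: "A \<in> block_ring e \<Longrightarrow> \<mu> ((+) h ` A) = \<mu> A"
  using shift_invariant unfolding shift_invariant_measure_def by blast+

lemma \<mu>_Diff:
  assumes "A \<in> block_ring e" "B \<in> block_ring e" "A \<subseteq> B"
  shows "\<mu> (B - A) = \<mu> B - \<mu> A"
  using \<mu>_Un_disjoint[of A "B - A"] assms by (simp add: block_ring_Diff Un_absorb1)

lemma \<mu>_mono: "A \<in> block_ring e \<Longrightarrow> B \<in> block_ring e \<Longrightarrow> A \<subseteq> B \<Longrightarrow> \<mu> A \<le> \<mu> B"
  using \<mu>_Diff[of A B] \<mu>_nonneg[of "B - A"] by (simp add: block_ring_Diff)

lemma \<mu>_Un_le:
  assumes "A \<in> block_ring e" "B \<in> block_ring e"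
  shows "\<mu> (A \<union> B) \<le> \<mu> A + \<mu> B"
  using \<mu>_Un_disjoint[of A "B - A"] \<mu>_mono[of "B - A" B] assms by (simp add: block_ring_Diff)

text \<open>Truncating at \<open>0\<close> treats two cases alike. If every pair of edges overlaps,
  the intersection really contains a vector of the space and the product formula applies; otherwise
  it is empty and one factor vanishes in all later partial products.\<close>

lemma block_Int_measure_LIMSEQ:
  assumes B: "abs_measurable_bounds a b" and B': "abs_measurable_bounds a' b'"
  shows "(\<lambda>n. \<Prod>j<n. max 0 (min (b j) (b' j) - max (a j) (a' j))) \<longlonglongrightarrow> \<mu> (block e a b \<inter> block e a' b')"
proof (cases "\<forall>j. max (a j) (a' j) < min (b j) (b' j)")
  case True
  let ?a = "\<lambda>j. max (a j) (a' j)" and ?b = "\<lambda>j. min (b j) (b' j)"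
  have nice: "abs_measurable_bounds ?a ?b"
    using abs_measurable_bounds_Int[OF B B'] True by blast
  have "\<mu> (block e ?a ?b) = lim (\<lambda>n. \<Prod>j<n. ?b j - ?a j)"
    using shift_invariant nice abs_measurable_boundsD[OF nice]
    unfolding shift_invariant_measure_def abs_measurable_bounds_def by blast
  moreover have "convergent (\<lambda>n. \<Prod>j<n. ?b j - ?a j)"
    by (rule convergent_prod_pos_part) (use True abs_measurable_boundsD(3)[OF nice] in auto)
  moreover have "max 0 (?b j - ?a j) = ?b j - ?a j" for j using True by (simp add: less_imp_le)
  ultimately show ?thesis by (simp only: block_Int convergent_LIMSEQ_iff)
next
  case False
  then obtain i where i: "min (b i) (b' i) \<le> max (a i) (a' i)"
    unfolding not_all not_less by blast
  then have "\<not> (max (a i) (a' i) \<le> z \<and> z < min (b i) (b' i))" for z by linarith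
  then have "block e (\<lambda>j. max (a j) (a' j)) (\<lambda>j. min (b j) (b' j)) = {}"
    unfolding block_def atLeastLessThan_iff by blast
  then have "block e a b \<inter> block e a' b' = {}" unfolding block_Int .
  moreover have "(\<Prod>j<n. max 0 (min (b j) (b' j) - max (a j) (a' j))) = 0" if "n > i" for n
    using that i by (auto intro!: prod_zero bexI[of _ i])
  then have "\<forall>\<^sub>F n in sequentially. 0 = (\<Prod>j<n. max 0 (min (b j) (b' j) - max (a j) (a' j)))"
    unfolding eventually_sequentially by (intro exI[of _ "Suc i"]) auto
  then have "(\<lambda>n. \<Prod>j<n. max 0 (min (b j) (b' j) - max (a j) (a' j))) \<longlonglongrightarrow> 0"
    by (rule Lim_transform_eventually[OF tendsto_const])
  ultimately show ?thesis by (simp only: \<mu>_empty)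
qed

lemma translated_block_Int_LIMSEQ:
  assumes B: "abs_measurable_bounds a b" and B': "abs_measurable_bounds a' b'"
  shows "(\<lambda>n. \<Prod>j<n. max 0 (min (b j + h \<bullet> e j) (b' j + h' \<bullet> e j) - max (a j + h \<bullet> e j) (a' j + h' \<bullet> e j)))
    \<longlonglongrightarrow> \<mu> ((+) h ` block e a b \<inter> (+) h' ` block e a' b')"
  unfolding block_translate
  by (intro block_Int_measure_LIMSEQ abs_measurable_bounds_translate B B')

lemma measurable_translated_block_Int:
  assumes B: "abs_measurable_bounds a b" and B': "abs_measurable_bounds a' b'"
  shows "(\<lambda>h. \<mu> ((+) h ` block e a b \<inter> (+) h' ` block e a' b')) \<in> borel_measurable borel"
proof (rule borel_measurable_LIMSEQ_real[OF translated_block_Int_LIMSEQ[OF B B']])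
  have [measurable]: "(\<lambda>h. h \<bullet> e j) \<in> borel_measurable borel" for j
    by (intro borel_measurable_continuous_onI continuous_intros)
  show "(\<lambda>h. \<Prod>j<n. max 0 (min (b j + h \<bullet> e j) (b' j + h' \<bullet> e j) - max (a j + h \<bullet> e j) (a' j + h' \<bullet> e j)))
      \<in> borel_measurable borel" for n
    by measurable
qed

text \<open>One sequence \<open>r\<close> serves all measures and all second shifts:
  \<open>h'\<close> only moves the centres of the weights, and \<open>\<nu>\<close> enters only
  through \<open>gaussian_coords\<close>.\<close>

lemma integral_translated_block_Int_le:
  assumes B: "abs_measurable_bounds a b" and B': "abs_measurable_bounds a' b'"
    and \<sigma>: "\<And>k. 0 < \<sigma> k" "\<And>k. \<sigma> k \<le> S" "\<not> summable \<sigma>"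
  shows "\<exists>r. r \<longlonglongrightarrow> 0 \<and> (\<forall>N \<nu> h'. gaussian_coords e \<sigma> N \<nu> \<longrightarrow>
    (LINT h|\<nu>. \<mu> ((+) h ` block e a b \<inter> (+) h' ` block e a' b')) \<le> r N)"
proof -
  define \<Lambda> where "\<Lambda> j = max 1 (b j - a j) * max 1 (b' j - a' j)" for j
  define M where "M = exp (\<Sum>j. max 0 (ln (b j - a j))) * exp (\<Sum>j. max 0 (ln (b' j - a' j)))"
  have \<Lambda>_prod: "(\<Prod>j\<in>A. \<Lambda> j) \<le> M" for A
    unfolding \<Lambda>_def prod.distrib M_def
    by (intro mult_mono prod_max_1_le_exp abs_measurable_boundsD(3)[OF B] abs_measurable_boundsD(3)[OF B'])
      (use abs_measurable_boundsD(1)[OF B] abs_measurable_boundsD(1)[OF B'] in \<open>auto intro!: prod_nonneg\<close>)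
  have \<Lambda>_le: "\<Lambda> j \<le> M" for j using \<Lambda>_prod[of "{j}"] by simp
  have \<Lambda>_nonneg: "0 \<le> \<Lambda> j" for j by (simp add: \<Lambda>_def)
  have M: "M > 0" by (simp add: M_def)
  have S: "S > 0" using \<sigma>(1,2)[of 0] by linarith
  \<comment> \<open>Small enough for both requirements of the overlap estimate in every coordinate,
    as \<open>M\<close> bounds \<Lambda> and \<open>S\<close> bounds \<sigma>.\<close>
  define \<kappa> where "\<kappa> = 1 / (M + S)"
  have \<kappa>: "\<kappa> > 0" "\<kappa> * \<Lambda> j \<le> 1" "\<kappa> * \<sigma> j \<le> 1" for j
    using M S \<Lambda>_le[of j] \<sigma>(2)[of j] by (auto simp: \<kappa>_def field_simps)
  define c :: real where "c = 1 - 1 / sqrt 2"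
  have c: "0 < c" "c \<le> 1" by (auto simp: c_def)
  define r where "r N = M * (\<Prod>k<N. 1 - \<kappa> * \<sigma> k * c)" for N
  have "(\<lambda>N. \<Prod>k<N. 1 - \<kappa> * \<sigma> k * c) \<longlonglongrightarrow> 0"
  proof (rule prod_one_minus_LIMSEQ_0)
    show "0 \<le> \<kappa> * \<sigma> k * c" for k using \<kappa>(1) \<sigma>(1)[of k] c by simp
    show "\<kappa> * \<sigma> k * c \<le> 1" for k
      using mult_mono[OF \<kappa>(3)[of k] c(2)] c by simp
    have "\<kappa> * c \<noteq> 0" using \<kappa> c by simp
    then show "\<not> summable (\<lambda>k. \<kappa> * \<sigma> k * c)"
      using \<sigma>(3) summable_cmult_iff[of "\<kappa> * c" \<sigma>] by (simp add: mult_ac)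
  qed
  then have "r \<longlonglongrightarrow> 0" unfolding r_def using tendsto_mult_right_zero by blast
  moreover have "(LINT h|\<nu>. \<mu> ((+) h ` block e a b \<inter> (+) h' ` block e a' b')) \<le> r N"
    if gc: "gaussian_coords e \<sigma> N \<nu>" for N \<nu> h'
  proof -
    interpret prob_space \<nu> using gc by (simp add: gaussian_coords_def)
    have sets_\<nu>: "sets \<nu> = sets borel" using gc by (simp add: gaussian_coords_def)
    define s where "s k = h' \<bullet> e k + (a' k + b' k - a k - b k) / 2" for k
    define w where "w k u = 1 - \<kappa> * \<sigma> k * (1 - exp (- ((u - s k) / \<sigma> k)\<^sup>2 / 2))" for k u
    let ?m = "\<lambda>h. \<mu> ((+) h ` block e a b \<inter> (+) h' ` block e a' b')"
    let ?ov = "\<lambda>h j. max 0 (min (b j + h \<bullet> e j) (b' j + h' \<bullet> e j) - max (a j + h \<bullet> e j) (a' j + h' \<bullet> e j))"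
    have w: "0 \<le> w k u" "w k u \<le> 1" for k u
    proof -
      have "\<kappa> * \<sigma> k * (1 - exp (- ((u - s k) / \<sigma> k)\<^sup>2 / 2)) \<le> 1 * 1"
        using \<kappa>(3)[of k] \<kappa>(1) \<sigma>(1)[of k] by (intro mult_mono) auto
      then show "0 \<le> w k u" by (simp add: w_def)
      show "w k u \<le> 1" using \<kappa>(1) \<sigma>(1)[of k] by (simp add: w_def)
    qed
    have ov_le: "?ov h j \<le> \<Lambda> j * w j (h \<bullet> e j)" for h j
      unfolding w_def s_def \<Lambda>_def
      by (rule interval_overlap_le) (use \<sigma>(1) \<kappa> in \<open>auto simp: \<Lambda>_def\<close>)
    \<comment> \<open>From coordinate \<open>N\<close> on the weights are replaced by
      \<open>1\<close>, while all the constants \<Lambda> are kept; their product is at most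
      \<open>M\<close> for every \<open>n\<close>, so the bound survives the limit.\<close>
    have m_le: "?m h \<le> M * (\<Prod>k<N. w k (h \<bullet> e k))" for h
    proof (rule LIMSEQ_le_const2[OF translated_block_Int_LIMSEQ[OF B B']], intro exI allI impI)
      fix n assume "N \<le> n"
      have "(\<Prod>j<n. ?ov h j) \<le> (\<Prod>j<n. \<Lambda> j * (if j \<in> {..<N} then w j (h \<bullet> e j) else 1))"
      proof (rule prod_mono)
        fix j
        have "\<Lambda> j * w j (h \<bullet> e j) \<le> \<Lambda> j * 1" by (intro mult_left_mono w \<Lambda>_nonneg)
        then show "0 \<le> ?ov h j \<and> ?ov h j \<le> \<Lambda> j * (if j \<in> {..<N} then w j (h \<bullet> e j) else 1)"
          using ov_le[of j h] by auto
      qed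
      also have "\<dots> = (\<Prod>j<n. \<Lambda> j) * (\<Prod>k<N. w k (h \<bullet> e k))"
      proof -
        have "{..<n} \<inter> {..<N} = {..<N}" using \<open>N \<le> n\<close> by auto
        then show ?thesis unfolding prod.distrib by (simp only: prod.inter_restrict[OF finite_lessThan, symmetric])
      qed
      also have "\<dots> \<le> M * (\<Prod>k<N. w k (h \<bullet> e k))"
        by (intro mult_right_mono \<Lambda>_prod prod_nonneg ballI w)
      finally show "(\<Prod>j<n. ?ov h j) \<le> M * (\<Prod>k<N. w k (h \<bullet> e k))" .
    qed
    have m_nonneg: "0 \<le> ?m h" for h
      by (intro \<mu>_nonneg block_ring_Int translate_block_ring abs_measurable_block_in_ring
          abs_measurable_boundsD(4) B B')
    have w_prod_le: "(\<Prod>k<N. w k (h \<bullet> e k)) \<le> 1" for h by (intro prod_le_1) (use w in auto)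
    have [measurable]: "(\<lambda>h. h \<bullet> e j) \<in> borel_measurable \<nu>" for j
      unfolding measurable_cong_sets[OF sets_\<nu> refl]
      by (intro borel_measurable_continuous_onI continuous_intros)
    have "(LINT h|\<nu>. ?m h) \<le> (LINT h|\<nu>. M * (\<Prod>k<N. w k (h \<bullet> e k)))"
    proof (rule integral_mono)
      have "?m h \<le> M" for h
        using m_le[of h] mult_left_mono[OF w_prod_le[of h], of M] M by linarith
      then show "integrable \<nu> ?m"
        using m_nonneg measurable_translated_block_Int[OF B B']
        by (intro integrable_const_bound[of _ M])
          (auto simp: measurable_cong_sets[OF sets_\<nu> refl])
      show "integrable \<nu> (\<lambda>h. M * (\<Prod>k<N. w k (h \<bullet> e k)))"
        by (rule integrable_const_bound[of _ M])
          (use M w w_prod_le in \<open>auto simp: abs_mult abs_prod mult_left_le w_def\<close>)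
    qed (rule m_le)
    also have "\<dots> \<le> r N"
      unfolding r_def integral_mult_right_zero w_def c_def
      by (intro mult_left_mono gaussian_coords_integral_prod_le[OF gc])
        (use \<sigma>(1) \<kappa> M in \<open>auto simp: less_imp_le\<close>)
    finally show ?thesis .
  qed
  ultimately show ?thesis by blast
qed

end

section \<open>Simple functions and the shift operators\<close>

context shift_measure begin

lemma completed_ringE:
  assumes "A \<in> completed_ring e \<mu>" "0 < \<epsilon>"
  obtains B C where "B \<in> block_ring e" "C \<in> block_ring e" "B \<subseteq> A" "A \<subseteq> C" "\<mu> (C - B) < \<epsilon>"
  using assms unfolding completed_ring_def by blast

lemma completed_ring_cover:
  assumes "A \<in> completed_ring e \<mu>"
  obtains C where "C \<in> block_ring e" "A \<subseteq> C"
proof -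
  obtain B C where "B \<in> block_ring e" "C \<in> block_ring e" "B \<subseteq> A" "A \<subseteq> C" "\<mu> (C - B) < 1"
    by (rule completed_ringE[OF assms zero_less_one])
  then show thesis using that by simp
qed

lemma block_ring_subset_completed_ring: "block_ring e \<subseteq> completed_ring e \<mu>"
  by (auto simp: completed_ring_def \<mu>_empty intro!: bexI)

text \<open>Sandwiching pairs combine: \<open>B \<union> B'\<close> and \<open>C \<union> C'\<close>
  enclose the union, \<open>B - C'\<close> and \<open>C - B'\<close> the difference. In both cases
  the gap lies in the union of the two given gaps.\<close>

lemma ring_of_sets_completed_ring: "ring_of_sets UNIV (completed_ring e \<mu>)"
proof -
  have op: "A \<union> A' \<in> completed_ring e \<mu> \<and> A - A' \<in> completed_ring e \<mu>"
    if A: "A \<in> completed_ring e \<mu>" and A': "A' \<in> completed_ring e \<mu>" for A A'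
  proof -
    have "\<exists>B\<in>block_ring e. \<exists>C\<in>block_ring e. \<exists>B'\<in>block_ring e. \<exists>C'\<in>block_ring e.
        B \<subseteq> A \<union> A' \<and> A \<union> A' \<subseteq> C \<and> \<mu> (C - B) < \<epsilon> \<and> B' \<subseteq> A - A' \<and> A - A' \<subseteq> C' \<and> \<mu> (C' - B') < \<epsilon>"
      if \<epsilon>: "\<epsilon> > 0" for \<epsilon>
    proof -
      obtain B C where B: "B \<in> block_ring e" "C \<in> block_ring e" "B \<subseteq> A" "A \<subseteq> C" "\<mu> (C - B) < \<epsilon> / 2"
        using completed_ringE[OF A, of "\<epsilon> / 2"] \<epsilon> by auto
      obtain B' C' where B': "B' \<in> block_ring e" "C' \<in> block_ring e" "B' \<subseteq> A'" "A' \<subseteq> C'" "\<mu> (C' - B') < \<epsilon> / 2"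
        using completed_ringE[OF A', of "\<epsilon> / 2"] \<epsilon> by auto
      note R = block_ring_Un block_ring_Diff B(1,2) B'(1,2)
      have small: "\<mu> X < \<epsilon>" if "X \<in> block_ring e" "X \<subseteq> (C - B) \<union> (C' - B')" for X
      proof -
        have "\<mu> X \<le> \<mu> ((C - B) \<union> (C' - B'))" by (rule \<mu>_mono) (intro that R)+
        also have "\<dots> \<le> \<mu> (C - B) + \<mu> (C' - B')" by (intro \<mu>_Un_le R)
        finally show ?thesis using B(5) B'(5) by linarith
      qed
      have "\<mu> ((C \<union> C') - (B \<union> B')) < \<epsilon>" by (rule small) (intro R, blast)
      moreover have "\<mu> ((C - B') - (B - C')) < \<epsilon>" by (rule small) (intro R, blast)
      moreover have "B \<union> B' \<subseteq> A \<union> A'" "A \<union> A' \<subseteq> C \<union> C'" "B - C' \<subseteq> A - A'" "A - A' \<subseteq> C - B'"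
        using B(3,4) B'(3,4) by blast+
      moreover have "B \<union> B' \<in> block_ring e" "C \<union> C' \<in> block_ring e" "B - C' \<in> block_ring e" "C - B' \<in> block_ring e"
        by (intro R)+
      ultimately show ?thesis by blast
    qed
    then show ?thesis unfolding completed_ring_def mem_Collect_eq by meson
  qed
  moreover have "{} \<in> completed_ring e \<mu>"
    using block_ring_subset_completed_ring block_ring_empty by blast
  ultimately show ?thesis by (simp add: ring_of_sets_iff)
qed

lemma completed_measure_le:
  assumes "A \<subseteq> C" "C \<in> block_ring e"
  shows "completed_measure e \<mu> A \<le> \<mu> C"
  unfolding completed_measure_def
  by (rule cINF_lower) (use assms \<mu>_nonneg in \<open>auto intro!: bdd_belowI[of _ 0]\<close>)

lemma completed_measure_block_ring: "A \<in> block_ring e \<Longrightarrow> completed_measure e \<mu> A = \<mu> A"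
proof (rule antisym[OF completed_measure_le])
  assume A: "A \<in> block_ring e"
  show "\<mu> A \<le> completed_measure e \<mu> A"
    unfolding completed_measure_def by (rule cINF_greatest) (use A \<mu>_mono in auto)
qed auto

lemma translate_completed_ring:
  assumes "A \<in> completed_ring e \<mu>"
  shows "(+) h ` A \<in> completed_ring e \<mu>"
  unfolding completed_ring_def mem_Collect_eq
proof (intro allI impI)
  fix \<epsilon> :: real assume "0 < \<epsilon>"
  then obtain B C where B: "B \<in> block_ring e" "C \<in> block_ring e" "B \<subseteq> A" "A \<subseteq> C" "\<mu> (C - B) < \<epsilon>"
    by (rule completed_ringE[OF assms])
  have "(+) h ` C - (+) h ` B = (+) h ` (C - B)" by (simp add: image_set_diff)
  then have "\<mu> ((+) h ` C - (+) h ` B) < \<epsilon>"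
    using B by (simp add: \<mu>_translate block_ring_Diff)
  then show "\<exists>B\<in>block_ring e. \<exists>C\<in>block_ring e. B \<subseteq> (+) h ` A \<and> (+) h ` A \<subseteq> C \<and> \<mu> (C - B) < \<epsilon>"
    using B by (intro bexI[of _ "(+) h ` B"] bexI[of _ "(+) h ` C"]) (auto simp: translate_block_ring)
qed

lemma completed_measure_translate:
  assumes "A \<in> completed_ring e \<mu>"
  shows "completed_measure e \<mu> ((+) h ` A) = completed_measure e \<mu> A"
proof (rule antisym)
  have le: "completed_measure e \<mu> ((+) h ` A) \<le> completed_measure e \<mu> A"
    if "A \<in> completed_ring e \<mu>" for h A
    unfolding completed_measure_def[of e \<mu> A]
  proof (rule cINF_greatest)
    show "{C \<in> block_ring e. A \<subseteq> C} \<noteq> {}"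
      using completed_ring_cover[OF that] by auto
    fix C assume "C \<in> {C \<in> block_ring e. A \<subseteq> C}"
    then show "completed_measure e \<mu> ((+) h ` A) \<le> \<mu> C"
      using completed_measure_le[of "(+) h ` A" "(+) h ` C"]
      by (auto simp: \<mu>_translate translate_block_ring)
  qed
  show "completed_measure e \<mu> ((+) h ` A) \<le> completed_measure e \<mu> A" by (rule le[OF assms])
  \<comment> \<open>The first inequality again, for the translated set and the inverse
    translation.\<close>
  show "completed_measure e \<mu> A \<le> completed_measure e \<mu> ((+) h ` A)"
    using le[OF translate_completed_ring[OF assms, of h], of "- h"] by (simp add: image_image)
qed

end

section \<open>Step functions as a translation invariant vector space\<close>

lemma step_fun_eq:
  assumes "disjoint_family_on B {..<n}" "k < n" "x \<in> B k"
  shows "step_fun n c B x = c k"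
proof -
  have "step_fun n c B x = (\<Sum>j<n. if j = k then c k else 0)"
    unfolding step_fun_def
  proof (rule sum.cong)
    fix j assume "j \<in> {..<n}"
    then show "c j * indicator (B j) x = (if j = k then c k else 0)"
      using assms by (auto simp: disjoint_family_on_def indicator_def)
  qed simp
  then show ?thesis using assms(2) by simp
qed

lemma step_fun_eq_0: "(\<And>k. k < n \<Longrightarrow> x \<notin> B k) \<Longrightarrow> step_fun n c B x = 0"
  unfolding step_fun_def by (rule sum.neutral) simp

lemma step_fun_translate: "step_fun n c B (x - h) = step_fun n c (\<lambda>k. (+) h ` B k) x"
  for h :: "'a::real_inner"
proof -
  have "x - h \<in> B k \<longleftrightarrow> x \<in> (+) h ` B k" for k
    by (auto intro!: image_eqI[of _ _ "x - h"])
  then have "indicator (B k) (x - h) = (indicator ((+) h ` B k) x :: complex)" for k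
    by (simp add: indicator_def)
  then show ?thesis by (simp only: step_fun_def)
qed

lemma indicator_translate: "indicator B (x - h) = (indicator ((+) h ` B) x :: complex)"
  for h :: "'a::real_inner"
  using step_fun_translate[of 1 "\<lambda>_. 1" "\<lambda>_. B" x h] by (simp add: step_fun_def)

context shift_measure begin

abbreviation "simples \<equiv> simple_funs e \<mu>"

text \<open>Level sets describe simple functions without a chosen disjoint family, so that closure
  under addition can be read off the sum. The value \<open>0\<close> is excluded because its level
  set need not lie in the ring.\<close>

lemma simple_funs_iff:
  "f \<in> simples \<longleftrightarrow> finite (range f) \<and> (\<forall>v. v \<noteq> 0 \<longrightarrow> f -` {v} \<in> completed_ring e \<mu>)"
proof
  interpret ring_of_sets UNIV "completed_ring e \<mu>" by (rule ring_of_sets_completed_ring)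
  assume "f \<in> simples"
  then obtain n c B where f: "f = step_fun n c B" and B: "\<And>k. k < n \<Longrightarrow> B k \<in> completed_ring e \<mu>"
    and dj: "disjoint_family_on B {..<n}"
    by (auto simp: simple_funs_def disjoint_sets_in_def)
  have "f x \<in> insert 0 (c ` {..<n})" for x
    using step_fun_eq[OF dj, of _ x c] step_fun_eq_0[of n x B c] unfolding f by (cases "\<exists>k<n. x \<in> B k") auto
  then have "finite (range f)" by (intro finite_subset[of "range f" "insert 0 (c ` {..<n})"]) auto
  moreover have "f -` {v} \<in> completed_ring e \<mu>" if v: "v \<noteq> 0" for v
  proof -
    have "f -` {v} = (\<Union>k\<in>{k. k < n \<and> c k = v}. B k)"
    proof (intro equalityI subsetI)
      fix x assume "x \<in> f -` {v}"
      then have fx: "step_fun n c B x = v" by (simp add: f)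
      then obtain k where "k < n" "x \<in> B k" using step_fun_eq_0[of n x B c] v by blast
      then show "x \<in> (\<Union>k\<in>{k. k < n \<and> c k = v}. B k)" using step_fun_eq[OF dj, of k x c] fx by auto
    qed (use step_fun_eq[OF dj] f in auto)
    also have "\<dots> \<in> completed_ring e \<mu>" by (rule finite_UN) (use B in auto)
    finally show ?thesis .
  qed
  ultimately show "finite (range f) \<and> (\<forall>v. v \<noteq> 0 \<longrightarrow> f -` {v} \<in> completed_ring e \<mu>)" by blast
next
  assume f: "finite (range f) \<and> (\<forall>v. v \<noteq> 0 \<longrightarrow> f -` {v} \<in> completed_ring e \<mu>)"
  define n where "n = card (range f - {0})"
  obtain c where c: "bij_betw c {..<n} (range f - {0})"
    using f ex_bij_betw_nat_finite[of "range f - {0}"] by (auto simp: n_def lessThan_atLeast0)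
  define B where "B k = f -` {c k}" for k
  have dj: "disjoint_family_on B {..<n}"
    using bij_betw_imp_inj_on[OF c] by (auto simp: disjoint_family_on_def B_def inj_on_def)
  have "step_fun n c B x = f x" for x
  proof (cases "f x = 0")
    case True
    then show ?thesis using bij_betwE[OF c] by (intro step_fun_eq_0[THEN trans]) (auto simp: B_def)
  next
    case False
    then obtain k where "k < n" "f x = c k"
      using bij_betw_imp_surj_on[OF c] by (metis (no_types, lifting) DiffI imageE lessThan_iff rangeI singletonD)
    then show ?thesis using step_fun_eq[OF dj, of k x c] by (simp add: B_def)
  qed
  then have "f = step_fun n c B" by auto
  moreover have "B k \<in> completed_ring e \<mu>" if "k < n" for k
    using f bij_betwE[OF c] that by (auto simp: B_def)
  ultimately show "f \<in> simples"
    using dj by (auto simp: simple_funs_def disjoint_sets_in_def)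
qed

lemma simples_add: "f \<in> simples \<Longrightarrow> g \<in> simples \<Longrightarrow> (\<lambda>x. f x + g x) \<in> simples"
proof -
  interpret ring_of_sets UNIV "completed_ring e \<mu>" by (rule ring_of_sets_completed_ring)
  assume "f \<in> simples" "g \<in> simples"
  then have f: "finite (range f)" "\<And>v. v \<noteq> 0 \<Longrightarrow> f -` {v} \<in> completed_ring e \<mu>"
    and g: "finite (range g)" "\<And>v. v \<noteq> 0 \<Longrightarrow> g -` {v} \<in> completed_ring e \<mu>"
    by (auto simp: simple_funs_iff)
  have "finite (range (\<lambda>x. f x + g x))"
    by (rule finite_subset[of _ "(\<lambda>(u, w). u + w) ` (range f \<times> range g)"]) (use f(1) g(1) in auto)
  moreover have "(\<lambda>x. f x + g x) -` {v} \<in> completed_ring e \<mu>" if v: "v \<noteq> 0" for v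
  proof -
    have supp: "k -` (- {0}) \<in> completed_ring e \<mu>"
      if "finite (range k)" "\<And>v. v \<noteq> 0 \<Longrightarrow> k -` {v} \<in> completed_ring e \<mu>" for k :: "'a \<Rightarrow> complex"
    proof -
      have "k -` (- {0}) = (\<Union>v\<in>range k - {0}. k -` {v})" by auto
      also have "\<dots> \<in> completed_ring e \<mu>" by (rule finite_UN) (use that in auto)
      finally show ?thesis .
    qed
    \<comment> \<open>As \<open>v \<noteq> 0\<close>, the values \<open>u\<close> and
      \<open>w\<close> are not both \<open>0\<close>. Intersecting with a level set of value
      \<open>0\<close> amounts to removing a support, which does lie in the ring.\<close>
    have piece: "f -` {u} \<inter> g -` {w} \<in> completed_ring e \<mu>" if "u + w = v" for u w
    proof (cases "u = 0")
      case True
      then have "f -` {u} \<inter> g -` {w} = g -` {w} - f -` (- {0})" by auto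
      then show ?thesis using Diff[OF g(2)[of w] supp[OF f]] that v True by auto
    next
      case u: False
      show ?thesis
      proof (cases "w = 0")
        case True
        then have "f -` {u} \<inter> g -` {w} = f -` {u} - g -` (- {0})" by auto
        then show ?thesis using Diff[OF f(2)[OF u] supp[OF g]] by simp
      qed (use u f g in auto)
    qed
    have "(\<lambda>x. f x + g x) -` {v} = (\<Union>(u, w)\<in>{p \<in> range f \<times> range g. fst p + snd p = v}. f -` {u} \<inter> g -` {w})"
      (is "?L = (\<Union>(u, w)\<in>?P. _)")
    proof (intro equalityI subsetI)
      fix x assume "x \<in> ?L"
      then show "x \<in> (\<Union>(u, w)\<in>?P. f -` {u} \<inter> g -` {w})"
        by (intro UN_I[of "(f x, g x)"]) auto
    qed auto
    also have "\<dots> \<in> completed_ring e \<mu>"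
      by (rule finite_UN) (use piece f(1) g(1) in auto)
    finally show ?thesis .
  qed
  ultimately show ?thesis by (simp add: simple_funs_iff)
qed

lemma simples_scale: "f \<in> simples \<Longrightarrow> (\<lambda>x. c * f x) \<in> simples"
proof -
  assume "f \<in> simples"
  then obtain n d B where f: "f = step_fun n d B" "disjoint_sets_in (completed_ring e \<mu>) n B"
    by (auto simp: simple_funs_def)
  have "(\<lambda>x. c * f x) = step_fun n (\<lambda>k. c * d k) B"
    unfolding f step_fun_def by (simp only: sum_distrib_left mult.assoc)
  then show ?thesis using f(2) by (auto simp: simple_funs_def)
qed

lemma disjoint_sets_in_translate:
  assumes "disjoint_sets_in (completed_ring e \<mu>) n B"
  shows "disjoint_sets_in (completed_ring e \<mu>) n (\<lambda>k. (+) h ` B k)"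
  using assms unfolding disjoint_sets_in_def disjoint_family_on_def
  by (simp add: translate_completed_ring image_Int[symmetric])

lemma simples_translate: "f \<in> simples \<Longrightarrow> (\<lambda>x. f (x - h)) \<in> simples"
proof -
  assume "f \<in> simples"
  then obtain n c B where f: "f = step_fun n c B" "disjoint_sets_in (completed_ring e \<mu>) n B"
    by (auto simp: simple_funs_def)
  have "(\<lambda>x. f (x - h)) = step_fun n c (\<lambda>k. (+) h ` B k)"
    by (simp add: f(1) step_fun_translate)
  then show ?thesis using disjoint_sets_in_translate[OF f(2)] by (auto simp: simple_funs_def)
qed

lemma simples_indicator: "A \<in> completed_ring e \<mu> \<Longrightarrow> indicator A \<in> simples"
  unfolding simple_funs_def mem_Collect_eq
  by (intro exI[of _ 1] exI[of _ "\<lambda>_. 1"] exI[of _ "\<lambda>_. A"])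
    (auto simp: step_fun_def disjoint_sets_in_def disjoint_family_on_def)

lemma simples_zero: "(\<lambda>_. 0) \<in> simples"
  unfolding simple_funs_def mem_Collect_eq
  by (intro exI[of _ 0]) (auto simp: step_fun_def disjoint_sets_in_def disjoint_family_on_def)

end

context onb begin

text \<open>The difference of two blocks is in general not a finite union of blocks, but its indicator is a
  linear combination of indicators of blocks.\<close>

inductive_set block_combinations :: "('a \<Rightarrow> complex) set" where
  zero: "(\<lambda>_. 0) \<in> block_combinations"
| add_block: "abs_measurable_bounds a b \<Longrightarrow> f \<in> block_combinations \<Longrightarrow>
    (\<lambda>x. c * indicator (block e a b) x + f x) \<in> block_combinations"

lemma block_combinations_add:
  "f \<in> block_combinations \<Longrightarrow> g \<in> block_combinations \<Longrightarrow> (\<lambda>x. f x + g x) \<in> block_combinations"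
  by (induction rule: block_combinations.induct)
    (auto simp: add.assoc intro: block_combinations.add_block)

lemma block_combinations_scale:
  "f \<in> block_combinations \<Longrightarrow> (\<lambda>x. d * f x) \<in> block_combinations"
proof (induction rule: block_combinations.induct)
  case (add_block a b f c)
  then show ?case using block_combinations.add_block[of a b "\<lambda>x. d * f x" "d * c"]
    by (simp add: distrib_left mult.assoc)
qed (simp add: block_combinations.zero)

lemma block_combinations_indicator:
  assumes "B \<in> abs_measurable_blocks e"
  shows "(\<lambda>x. c * indicator B x) \<in> block_combinations"
proof (cases "B = {}")
  case False
  then obtain a b where "abs_measurable_bounds a b" "B = block e a b"
    using abs_measurable_blocks_cases assms by blast
  then show ?thesis using block_combinations.add_block[OF _ block_combinations.zero] by simp
qed (simp add: block_combinations.zero)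

text \<open>Nonempty intersections of absolutely measurable blocks are such blocks again, so the
  combinations form an algebra; this brings unions and differences within reach.\<close>

lemma block_combinations_mult:
  assumes f: "f \<in> block_combinations" and g: "g \<in> block_combinations"
  shows "(\<lambda>x. f x * g x) \<in> block_combinations"
proof -
  have block: "(\<lambda>x. indicator (block e a b) x * g x) \<in> block_combinations"
    if B: "abs_measurable_bounds a b" for a b
    using g
  proof (induction rule: block_combinations.induct)
    case (add_block a' b' g c)
    let ?I = "block e a b \<inter> block e a' b'"
    have "(\<lambda>x. c * indicator ?I x) \<in> block_combinations"
    proof (cases "?I = {}")
      case False
      then obtain z where "\<And>j. max (a j) (a' j) \<le> z \<bullet> e j \<and> z \<bullet> e j < min (b j) (b' j)"
        by (auto simp: block_def)
      then have "max (a j) (a' j) < min (b j) (b' j)" for j by (meson le_less_trans)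
      then have "?I \<in> abs_measurable_blocks e"
        using abs_measurable_bounds_Int[OF B add_block(1)] abs_measurable_boundsD(4) by (simp add: block_Int)
      then show ?thesis by (rule block_combinations_indicator)
    qed (simp add: block_combinations.zero)
    then have "(\<lambda>x. c * indicator ?I x + indicator (block e a b) x * g x) \<in> block_combinations"
      using add_block.IH by (rule block_combinations_add)
    then show ?case by (simp add: indicator_inter_arith distrib_left mult.left_commute)
  qed (simp add: block_combinations.zero)
  show ?thesis using f
  proof (induction rule: block_combinations.induct)
    case (add_block a b f c)
    have "(\<lambda>x. c * (indicator (block e a b) x * g x) + f x * g x) \<in> block_combinations"
      by (rule block_combinations_add[OF block_combinations_scale[OF block[OF add_block(1)]] add_block.IH])
    then show ?case by (simp add: distrib_right mult.assoc)
  qed (simp add: block_combinations.zero)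
qed

text \<open>The sets whose indicator is a combination of blocks form a ring, since indicators of
  unions and differences are polynomials in the given indicators.\<close>

lemma block_ring_indicator:
  assumes "A \<in> block_ring e"
  shows "indicator A \<in> block_combinations"
proof -
  have op: "indicator (A \<union> B) \<in> block_combinations \<and> indicator (A - B) \<in> block_combinations"
    if A: "indicator A \<in> block_combinations" and B: "indicator B \<in> block_combinations" for A B
  proof
    have AB: "(\<lambda>x. (- 1) * (indicator A x * indicator B x)) \<in> block_combinations"
      by (intro block_combinations_scale block_combinations_mult A B)
    have "indicator (A \<union> B) = (\<lambda>x. indicator A x + (indicator B x + (- 1) * (indicator A x * indicator B x :: complex)))"
      by (auto simp: indicator_def)
    then show "indicator (A \<union> B) \<in> block_combinations"
      using block_combinations_add[OF A block_combinations_add[OF B AB]] by simp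
    have "indicator (A - B) = (\<lambda>x. indicator A x + (- 1) * (indicator A x * indicator B x :: complex))"
      by (auto simp: indicator_def)
    then show "indicator (A - B) \<in> block_combinations"
      using block_combinations_add[OF A AB] by simp
  qed
  have "(indicator {} :: 'a \<Rightarrow> complex) = (\<lambda>_. 0)" by auto
  then have "indicator {} \<in> block_combinations" by (simp add: block_combinations.zero)
  then have "ring_of_sets UNIV {A. (indicator A :: 'a \<Rightarrow> complex) \<in> block_combinations}"
    using op by (auto simp: ring_of_sets_iff)
  then show ?thesis
    using assms block_combinations_indicator[of _ 1] unfolding block_ring_def
    by (elim hull_induct) auto
qed

end

section \<open>Shifts, dense subsets and inner products in the completed space\<close>

locale simple_completion = shift_measure e \<mu> for e :: "nat \<Rightarrow> 'a::{real_inner, complete_space}" and \<mu> +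
  fixes \<iota> :: "('a \<Rightarrow> complex) \<Rightarrow> 'h::complex_hilbert"
  assumes completion: "simple_funs_completion e \<mu> \<iota>"
begin

lemma \<iota>_add: "f \<in> simples \<Longrightarrow> g \<in> simples \<Longrightarrow> \<iota> (\<lambda>x. f x + g x) = \<iota> f + \<iota> g"
  and \<iota>_scale: "f \<in> simples \<Longrightarrow> \<iota> (\<lambda>x. c * f x) = c *\<^sub>C \<iota> f"
  and \<iota>_norm: "disjoint_sets_in (completed_ring e \<mu>) n B \<Longrightarrow>
    norm (\<iota> (step_fun n d B)) = sqrt (\<Sum>k<n. (cmod (d k))\<^sup>2 * completed_measure e \<mu> (B k))"
  and \<iota>_dense: "closure (\<iota> ` simples) = UNIV"
  using completion unfolding simple_funs_completion_def by blast+

lemma \<iota>_diff: 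
  assumes "f \<in> simples" "g \<in> simples"
  shows "\<iota> (\<lambda>x. f x - g x) = \<iota> f - \<iota> g"
proof -
  have "\<iota> (\<lambda>x. f x + (- 1) * g x) = \<iota> f + (- 1) *\<^sub>C \<iota> g"
    using assms by (simp only: \<iota>_add simples_scale \<iota>_scale)
  moreover have "(- 1) *\<^sub>C v = - v" for v :: 'h using scaleC_complex_of_real[of "- 1" v] by simp
  ultimately show ?thesis by simp
qed

lemma simples_diff: "f \<in> simples \<Longrightarrow> g \<in> simples \<Longrightarrow> (\<lambda>x. f x - g x) \<in> simples"
  using simples_add[OF _ simples_scale[of g "- 1"]] by simp

lemma \<iota>_zero: "\<iota> (\<lambda>_. 0) = 0"
  using \<iota>_diff[OF simples_zero simples_zero] by simp

lemma norm_\<iota>_translate: 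
  assumes "f \<in> simples"
  shows "norm (\<iota> (\<lambda>x. f (x - h))) = norm (\<iota> f)"
proof -
  obtain n c B where f: "f = step_fun n c B" and B: "disjoint_sets_in (completed_ring e \<mu>) n B"
    using assms by (auto simp: simple_funs_def)
  have "(\<lambda>x. f (x - h)) = step_fun n c (\<lambda>k. (+) h ` B k)" by (simp add: f step_fun_translate)
  then have "norm (\<iota> (\<lambda>x. f (x - h))) = sqrt (\<Sum>k<n. (cmod (c k))\<^sup>2 * completed_measure e \<mu> ((+) h ` B k))"
    using \<iota>_norm[OF disjoint_sets_in_translate[OF B]] by simp
  also have "\<dots> = norm (\<iota> f)"
    unfolding f \<iota>_norm[OF B] using B by (simp add: disjoint_sets_in_def completed_measure_translate)
  finally show ?thesis .
qed

abbreviation "shift \<equiv> shift_op e \<mu> \<iota>"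

text \<open>\<open>shift_op\<close> is a definite description. Translation is isometric on simple
  functions, hence well defined on the dense image of \<open>\<iota>\<close>, and extends as a
  Lipschitz map; continuity and density make the extension unique.\<close>

lemma shift_op_characterization:
  "1-lipschitz_on UNIV (shift h) \<and> (\<forall>f\<in>simples. shift h (\<iota> f) = \<iota> (\<lambda>x. f (x - h)))"
proof -
  \<comment> \<open>\<open>inv_into\<close> picks some representative of \<open>v\<close>; the
    isometry \<open>isom\<close> makes the outcome independent of the pick.\<close>
  define T0 where "T0 v = \<iota> (\<lambda>x. inv_into simples \<iota> v (x - h))" for v
  have isom: "norm (\<iota> (\<lambda>x. f (x - h)) - \<iota> (\<lambda>x. g (x - h))) = norm (\<iota> f - \<iota> g)"
    if "f \<in> simples" "g \<in> simples" for f g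
    using norm_\<iota>_translate[OF simples_diff[OF that], of h] that
    by (simp add: \<iota>_diff simples_translate)
  have T0: "T0 (\<iota> f) = \<iota> (\<lambda>x. f (x - h))" if f: "f \<in> simples" for f
  proof -
    have g: "inv_into simples \<iota> (\<iota> f) \<in> simples" "\<iota> (inv_into simples \<iota> (\<iota> f)) = \<iota> f"
      using inv_into_into[of "\<iota> f" \<iota> simples] f_inv_into_f[of "\<iota> f" \<iota> simples] f by simp_all
    show ?thesis using isom[OF g(1) f] g(2) by (simp add: T0_def)
  qed
  have "1-lipschitz_on (\<iota> ` simples) T0"
    by (rule lipschitz_onI) (auto simp: T0 dist_norm isom)
  then obtain T where T: "1-lipschitz_on UNIV T" "\<forall>v\<in>\<iota> ` simples. T v = T0 v"
    using lipschitz_extend_closure[of 1 "\<iota> ` simples" T0] \<iota>_dense by auto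
  have "shift h = T"
    unfolding shift_op_def
  proof (rule the_equality)
    show "continuous_on UNIV T \<and> (\<forall>f\<in>simples. T (\<iota> f) = \<iota> (\<lambda>x. f (x - h)))"
      using T T0 by (auto intro: lipschitz_on_continuous_on)
    fix T' assume T': "continuous_on UNIV T' \<and> (\<forall>f\<in>simples. T' (\<iota> f) = \<iota> (\<lambda>x. f (x - h)))"
    have "closed {v. T' v = T v}"
      by (rule closed_Collect_eq) (use T T' in \<open>auto intro: lipschitz_on_continuous_on\<close>)
    then have "closure (\<iota> ` simples) \<subseteq> {v. T' v = T v}"
      by (intro closure_minimal) (use T T' T0 in auto)
    then show "T' = T" using \<iota>_dense by auto
  qed
  then show ?thesis using T T0 by auto
qed

lemma shift_\<iota>: "f \<in> simples \<Longrightarrow> shift h (\<iota> f) = \<iota> (\<lambda>x. f (x - h))"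
  using shift_op_characterization by blast

lemma norm_shift_diff_le: "norm (shift h u - shift h v) \<le> norm (u - v)"
  using lipschitz_onD[of 1 UNIV "shift h" u v] shift_op_characterization[of h]
  by (simp add: dist_norm)

lemma shift_zero: "shift h 0 = 0"
  using shift_\<iota>[OF simples_zero, of h] by (simp add: \<iota>_zero)

lemma norm_shift_le: "norm (shift h u) \<le> norm u"
  using norm_shift_diff_le[of h u 0] by (simp add: shift_zero)

lemma shift_linear_simples:
  assumes "f \<in> simples" "g \<in> simples"
  shows "shift h (\<iota> (\<lambda>x. c * f x + g x)) = c *\<^sub>C shift h (\<iota> f) + shift h (\<iota> g)"
proof -
  have "shift h (\<iota> (\<lambda>x. c * f x + g x)) = \<iota> (\<lambda>x. c * f (x - h) + g (x - h))"
    by (intro shift_\<iota> simples_add simples_scale assms)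
  also have "\<dots> = c *\<^sub>C \<iota> (\<lambda>x. f (x - h)) + \<iota> (\<lambda>x. g (x - h))"
    using assms by (simp only: \<iota>_add \<iota>_scale simples_scale simples_translate)
  finally show ?thesis using assms by (simp only: shift_\<iota>)
qed

lemma block_indicator_simples:
  assumes "abs_measurable_bounds a b"
  shows "indicator (block e a b) \<in> simples"
  using abs_measurable_boundsD(4)[OF assms] abs_measurable_block_in_ring
    block_ring_subset_completed_ring by (intro simples_indicator) auto

lemma block_combinations_simples: "f \<in> block_combinations \<Longrightarrow> f \<in> simples"
proof (induction rule: block_combinations.induct)
  case (add_block a b f c)
  then show ?case by (intro simples_add simples_scale block_indicator_simples)
qed (rule simples_zero)

text \<open>Each set is replaced by an inner approximation from the ring. Inner approximations stay
  disjoint, and the error is a step function on the differences, so the isometry formula gives its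
  norm.\<close>

lemma block_combinations_dense: "closure (\<iota> ` block_combinations) = UNIV"
proof -
  have "\<iota> f \<in> closure (\<iota> ` block_combinations)" if fs: "f \<in> simples" for f
    unfolding closure_approachable
  proof (intro allI impI)
    fix r :: real assume r: "0 < r"
    obtain n c B where f: "f = step_fun n c B" and B: "\<And>k. k < n \<Longrightarrow> B k \<in> completed_ring e \<mu>"
      and dj: "disjoint_family_on B {..<n}"
      using fs by (auto simp: simple_funs_def disjoint_sets_in_def)
    \<comment> \<open>The summand \<open>1\<close> excludes division by zero and makes the final
      estimate strict.\<close>
    define K where "K = 1 + (\<Sum>k<n. (cmod (c k))\<^sup>2)"
    have K: "K > 0" by (simp add: K_def add_pos_nonneg sum_nonneg)
    define \<delta> where "\<delta> = r\<^sup>2 / K"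
    have \<delta>: "\<delta> > 0" using r K by (simp add: \<delta>_def)
    have "\<exists>A C. A \<in> block_ring e \<and> C \<in> block_ring e \<and> A \<subseteq> B k \<and> B k \<subseteq> C \<and> \<mu> (C - A) < \<delta>" if "k < n" for k
      using completed_ringE[OF B[OF that] \<delta>] by metis
    then obtain A C where A: "\<And>k. k < n \<Longrightarrow> A k \<in> block_ring e" "\<And>k. k < n \<Longrightarrow> C k \<in> block_ring e"
      "\<And>k. k < n \<Longrightarrow> A k \<subseteq> B k" "\<And>k. k < n \<Longrightarrow> B k \<subseteq> C k" "\<And>k. k < n \<Longrightarrow> \<mu> (C k - A k) < \<delta>"
      by metis
    have "m \<le> n \<Longrightarrow> step_fun m c A \<in> block_combinations" for m
    proof (induction m)
      case 0
      then show ?case using block_combinations.zero by (simp add: step_fun_def)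
    next
      case (Suc m)
      then have "step_fun m c A \<in> block_combinations" "A m \<in> block_ring e" using A by auto
      then have "(\<lambda>x. step_fun m c A x + c m * indicator (A m) x) \<in> block_combinations"
        by (intro block_combinations_add block_combinations_scale block_ring_indicator)
      then show ?case by (simp only: step_fun_def sum.lessThan_Suc)
    qed
    then have g: "step_fun n c A \<in> block_combinations" by blast
    have "(\<lambda>x. f x - step_fun n c A x) = step_fun n c (\<lambda>k. B k - A k)"
    proof
      fix x
      have "indicator (B k - A k) x = (indicator (B k) x - indicator (A k) x :: complex)" if "k < n" for k
        using A(3)[OF that] by (auto simp: indicator_def)
      then show "f x - step_fun n c A x = step_fun n c (\<lambda>k. B k - A k) x"
        unfolding f step_fun_def sum_subtractf[symmetric] by (simp add: right_diff_distrib)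
    qed
    then have "\<iota> f - \<iota> (step_fun n c A) = \<iota> (step_fun n c (\<lambda>k. B k - A k))"
      using \<iota>_diff[OF fs block_combinations_simples[OF g]] by simp
    moreover have "norm (\<iota> (step_fun n c (\<lambda>k. B k - A k))) < r"
    proof -
      interpret ring_of_sets UNIV "completed_ring e \<mu>" by (rule ring_of_sets_completed_ring)
      have "disjoint_sets_in (completed_ring e \<mu>) n (\<lambda>k. B k - A k)"
        unfolding disjoint_sets_in_def
      proof (intro conjI allI impI)
        show "B k - A k \<in> completed_ring e \<mu>" if "k < n" for k
          using B[OF that] A(1)[OF that] block_ring_subset_completed_ring by (intro Diff) auto
        show "disjoint_family_on (\<lambda>k. B k - A k) {..<n}"
          unfolding disjoint_family_on_def
        proof (intro ballI impI)
          fix i j assume "i \<in> {..<n}" "j \<in> {..<n}" "i \<noteq> j"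
          then have "B i \<inter> B j = {}" by (rule disjoint_family_onD[OF dj])
          then show "(B i - A i) \<inter> (B j - A j) = {}" by auto
        qed
      qed
      then have "norm (\<iota> (step_fun n c (\<lambda>k. B k - A k))) =
          sqrt (\<Sum>k<n. (cmod (c k))\<^sup>2 * completed_measure e \<mu> (B k - A k))" by (rule \<iota>_norm)
      also have "(\<Sum>k<n. (cmod (c k))\<^sup>2 * completed_measure e \<mu> (B k - A k)) \<le> (\<Sum>k<n. (cmod (c k))\<^sup>2 * \<delta>)"
      proof (intro sum_mono mult_left_mono)
        fix k assume "k \<in> {..<n}"
        then have k: "k < n" by simp
        have "completed_measure e \<mu> (B k - A k) \<le> \<mu> (C k - A k)"
          using A(4)[OF k] by (intro completed_measure_le block_ring_Diff A k) auto
        then show "completed_measure e \<mu> (B k - A k) \<le> \<delta>" using A(5)[OF k] by linarith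
      qed simp
      also have "\<dots> = (K - 1) * \<delta>" by (simp add: K_def sum_distrib_right)
      also have "\<dots> < K * \<delta>" using \<delta> by simp
      also have "\<dots> = r\<^sup>2" using K by (simp add: \<delta>_def)
      finally show ?thesis using r by (simp add: real_sqrt_less_iff)
    qed
    ultimately show "\<exists>y\<in>\<iota> ` block_combinations. dist y (\<iota> f) < r"
      using g by (intro bexI[of _ "\<iota> (step_fun n c A)"]) (simp_all add: dist_norm norm_minus_commute)
  qed
  then have "closure (\<iota> ` simples) \<subseteq> closure (\<iota> ` block_combinations)"
    by (intro closure_minimal) auto
  then show ?thesis using \<iota>_dense by auto
qed

text \<open>Only norms of step functions are prescribed, so inner products are recovered from them.
  For disjoint sets the squared norm of \<open>u + c *\<^sub>C v\<close> is the same for all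
  unimodular \<open>c\<close>, and \<open>c = 1\<close>, \<open>c = \<i>\<close> give orthogonality;
  other pairs are split along their intersection.\<close>

lemma cinner_\<iota>_indicator:
  assumes A: "A \<in> block_ring e" and B: "B \<in> block_ring e"
  shows "cinner (\<iota> (indicator A)) (\<iota> (indicator B)) = complex_of_real (\<mu> (A \<inter> B))"
proof -
  have simple: "indicator A \<in> simples" if "A \<in> block_ring e" for A
    using that block_ring_subset_completed_ring by (intro simples_indicator) auto
  have self: "cinner (\<iota> (indicator A)) (\<iota> (indicator A)) = complex_of_real (\<mu> A)"
    if "A \<in> block_ring e" for A
  proof -
    have "disjoint_sets_in (completed_ring e \<mu>) 1 (\<lambda>_. A)"
      using that block_ring_subset_completed_ring by (auto simp: disjoint_sets_in_def disjoint_family_on_def)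
    from \<iota>_norm[OF this, of "\<lambda>_. 1"] have "norm (\<iota> (indicator A)) = sqrt (\<mu> A)"
      using that by (simp add: step_fun_def completed_measure_block_ring)
    then show ?thesis using \<mu>_nonneg[OF that] by (simp add: cinner_self)
  qed
  have orth: "cinner (\<iota> (indicator A)) (\<iota> (indicator B)) = 0"
    if A: "A \<in> block_ring e" and B: "B \<in> block_ring e" and AB: "A \<inter> B = {}" for A B
  proof -
    define u v where "u = \<iota> (indicator A)" and "v = \<iota> (indicator B)"
    have "Re (cinner u (c *\<^sub>C v)) = 0" if c: "cmod c = 1" for c
    proof -
      define S where "S k = (if k = 0 then A else B)" for k :: nat
      define d where "d k = (if k = 0 then 1 else c)" for k :: nat
      have "disjoint_sets_in (completed_ring e \<mu>) 2 S"
        using A B AB block_ring_subset_completed_ring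
        by (auto simp: disjoint_sets_in_def disjoint_family_on_def S_def)
      from \<iota>_norm[OF this, of d] have "norm (\<iota> (step_fun 2 d S)) = sqrt (\<mu> A + \<mu> B)"
        using A B c by (simp add: numeral_2_eq_2 S_def d_def completed_measure_block_ring)
      moreover have "step_fun 2 d S = (\<lambda>x. indicator A x + c * indicator B x)"
        by (simp add: step_fun_def fun_eq_iff numeral_2_eq_2 S_def d_def)
      moreover have "\<iota> (\<lambda>x. indicator A x + c * indicator B x) = u + c *\<^sub>C v"
        unfolding u_def v_def using simple[OF A] simple[OF B]
        by (simp only: \<iota>_add simples_scale \<iota>_scale)
      ultimately have "(norm (u + c *\<^sub>C v))\<^sup>2 = \<mu> A + \<mu> B"
        using \<mu>_nonneg[OF A] \<mu>_nonneg[OF B] by simp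
      moreover have "complex_of_real ((norm u)\<^sup>2) = complex_of_real (\<mu> A)"
        "complex_of_real ((norm v)\<^sup>2) = complex_of_real (\<mu> B)"
        unfolding cinner_self[symmetric] u_def v_def by (rule self A B)+
      ultimately show ?thesis using norm_add_sq[of u "c *\<^sub>C v"] c by (simp add: norm_scaleC del: of_real_power)
    qed
    from this[of 1] this[of \<i>] have "cinner u v = 0"
      by (simp add: cinner_scaleC_right complex_eq_iff)
    then show ?thesis by (simp add: u_def v_def)
  qed
  have split: "\<iota> (indicator X) = \<iota> (indicator (X \<inter> Y)) + \<iota> (indicator (X - Y))"
    if "X \<in> block_ring e" "Y \<in> block_ring e" for X Y
  proof -
    have "indicator X = (\<lambda>x. indicator (X \<inter> Y) x + indicator (X - Y) x :: complex)"
      by (auto simp: indicator_def)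
    then show ?thesis
      using \<iota>_add[OF simple[OF block_ring_Int[OF that]] simple[OF block_ring_Diff[OF that]]] by simp
  qed
  have "cinner (\<iota> (indicator A)) (\<iota> (indicator B)) =
      cinner (\<iota> (indicator (A \<inter> B))) (\<iota> (indicator (B \<inter> A)))"
    unfolding split[OF A B] split[OF B A] cinner_add_left cinner_add_right
    by (simp add: orth A B block_ring_Int block_ring_Diff Int_Diff Diff_Int_distrib Int_ac Diff_Int2)
  also have "\<dots> = complex_of_real (\<mu> (A \<inter> B))"
    using self[OF block_ring_Int[OF A B]] by (simp only: Int_commute)
  finally show ?thesis .
qed

end

section \<open>Averaging the shifts\<close>

context simple_completion begin

text \<open>For two blocks this is measurability of the overlap, a limit of finite products of
  coordinate functions; sesquilinearity and pointwise limits along dense sequences do the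
  rest.\<close>

lemma measurable_cinner_shift: "(\<lambda>h. cinner (shift h u) v) \<in> borel_measurable borel"
proof -
  have block_block: "(\<lambda>h. cinner (shift h (\<iota> (indicator (block e a b)))) (\<iota> (indicator (block e a' b'))))
      \<in> borel_measurable borel"
    if B: "abs_measurable_bounds a b" and B': "abs_measurable_bounds a' b'" for a b a' b'
  proof -
    have R: "block e a b \<in> block_ring e" "block e a' b' \<in> block_ring e"
      using B B' by (simp_all add: abs_measurable_boundsD(4) abs_measurable_block_in_ring)
    \<comment> \<open>The second block is written as its translate by \<open>0\<close> to fit the
      formula for two translates.\<close>
    have "cinner (shift h (\<iota> (indicator (block e a b)))) (\<iota> (indicator (block e a' b'))) =
        complex_of_real (\<mu> ((+) h ` block e a b \<inter> (+) 0 ` block e a' b'))" for h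
      using R block_ring_subset_completed_ring
      by (subst shift_\<iota>) (auto simp: simples_indicator indicator_translate
          translate_block_ring cinner_\<iota>_indicator)
    then show ?thesis using measurable_translated_block_Int[OF B B', of 0] by simp measurable
  qed
  have block: "(\<lambda>h. cinner (shift h (\<iota> (indicator (block e a b)))) (\<iota> g)) \<in> borel_measurable borel"
    if B: "abs_measurable_bounds a b" and g: "g \<in> block_combinations" for a b g
    using g
  proof (induction rule: block_combinations.induct)
    case (add_block a' b' g c)
    have "\<iota> (\<lambda>x. c * indicator (block e a' b') x + g x) = c *\<^sub>C \<iota> (indicator (block e a' b')) + \<iota> g"
      by (simp only: \<iota>_add \<iota>_scale simples_scale block_combinations_simples[OF add_block(2)]
          block_indicator_simples[OF add_block(1)])
    then show ?case
      using block_block[OF B add_block(1)] add_block.IH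
      by (simp add: cinner_add_right cinner_scaleC_right)
  qed (simp add: \<iota>_zero)
  have comb: "(\<lambda>h. cinner (shift h (\<iota> f)) (\<iota> g)) \<in> borel_measurable borel"
    if f: "f \<in> block_combinations" and g: "g \<in> block_combinations" for f g
    using f
  proof (induction rule: block_combinations.induct)
    case (add_block a b f c)
    show ?case
      using block[OF add_block(1) g] add_block.IH
      by (simp add: shift_linear_simples block_combinations_simples[OF add_block(2)]
          block_indicator_simples[OF add_block(1)] cinner_add_left cinner_scaleC_left)
  qed (simp add: \<iota>_zero shift_zero)
  have approx: "\<exists>f. (\<forall>n::nat. f n \<in> block_combinations) \<and> (\<lambda>n. \<iota> (f n)) \<longlonglongrightarrow> w" for w
  proof -
    obtain y where y: "\<And>n::nat. y n \<in> \<iota> ` block_combinations" "y \<longlonglongrightarrow> w"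
      using block_combinations_dense closure_sequential[of w] by blast
    then have "\<exists>f. f \<in> block_combinations \<and> y n = \<iota> f" for n by blast
    then obtain f where "\<And>n. f n \<in> block_combinations \<and> y n = \<iota> (f n)" by metis
    moreover from this have "y = (\<lambda>n. \<iota> (f n))" by auto
    ultimately show ?thesis using y(2) by (intro exI[of _ f]) simp
  qed
  obtain f where f: "\<And>n::nat. f n \<in> block_combinations" "(\<lambda>n. \<iota> (f n)) \<longlonglongrightarrow> u" using approx by blast
  obtain g where g: "\<And>n::nat. g n \<in> block_combinations" "(\<lambda>n. \<iota> (g n)) \<longlonglongrightarrow> v" using approx by blast
  show ?thesis
  proof (rule borel_measurable_LIMSEQ_metric)
    show "(\<lambda>h. cinner (shift h (\<iota> (f n))) (\<iota> (g n))) \<in> borel_measurable borel" for n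
      using comb f(1) g(1) by blast
    fix h
    have "continuous_on UNIV (shift h)"
      using shift_op_characterization lipschitz_on_continuous_on by blast
    then have "(\<lambda>n. shift h (\<iota> (f n))) \<longlonglongrightarrow> shift h u"
      using f(2) by (rule continuous_on_tendsto_compose) auto
    then show "(\<lambda>n. cinner (shift h (\<iota> (f n))) (\<iota> (g n))) \<longlonglongrightarrow> cinner (shift h u) v"
      using g(2) by (rule tendsto_cinner)
  qed
qed

lemma integrable_cinner_shift:
  assumes "prob_space \<nu>" "sets \<nu> = sets borel"
  shows "integrable \<nu> (\<lambda>h. cinner (shift h u) v)"
proof (rule finite_measure.integrable_const_bound[OF prob_space.finite_measure[OF assms(1)], of _ "norm u * norm v"])
  have "cmod (cinner (shift h u) v) \<le> norm u * norm v" for h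
    by (rule order.trans[OF cinner_Cauchy_Schwarz]) (intro mult_right_mono norm_shift_le norm_ge_zero)
  then show "AE h in \<nu>. cmod (cinner (shift h u) v) \<le> norm u * norm v" by simp
  show "(\<lambda>h. cinner (shift h u) v) \<in> borel_measurable \<nu>"
    using measurable_cinner_shift measurable_cong_sets[OF assms(2) refl] by blast
qed

text \<open>Used with \<open>w = 0\<close> to bound the functional that is represented by the Pettis
  integral, and with another shifted vector to show that averaging is contractive.\<close>

lemma cmod_integral_cinner_shift_le:
  assumes "prob_space \<nu>" "sets \<nu> = sets borel" "\<And>h. norm (shift h u - w h) \<le> K"
    "\<And>v. integrable \<nu> (\<lambda>h. cinner (w h) v)"
  shows "cmod (LINT h|\<nu>. cinner (shift h u - w h) v) \<le> K * norm v"
proof -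
  interpret prob_space \<nu> by fact
  have int: "integrable \<nu> (\<lambda>h. cinner (shift h u - w h) v)"
    unfolding cinner_diff_left using assms by (intro Bochner_Integration.integrable_diff integrable_cinner_shift)
  have "cmod (LINT h|\<nu>. cinner (shift h u - w h) v) \<le> (LINT h|\<nu>. cmod (cinner (shift h u - w h) v))"
    by (rule integral_norm_bound)
  also have "\<dots> \<le> (LINT h|\<nu>. K * norm v)"
  proof (rule integral_mono)
    show "cmod (cinner (shift h u - w h) v) \<le> K * norm v" for h
      by (rule order.trans[OF cinner_Cauchy_Schwarz]) (intro mult_right_mono assms norm_ge_zero)
  qed (use int in auto)
  finally show ?thesis by (simp add: prob_space)
qed

text \<open>The integral is a bounded conjugate linear functional of the test vector, so Riesz
  representation gives existence; uniqueness is required because \<open>pettis_integral\<close> is a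
  description.\<close>

lemma has_pettis_integral_average:
  assumes \<nu>: "prob_space \<nu>" "sets \<nu> = sets borel"
  shows "has_pettis_integral \<nu> (\<lambda>h. shift h u) (pettis_integral \<nu> (\<lambda>h. shift h u))"
proof -
  note int = integrable_cinner_shift[OF \<nu>]
  have "\<exists>g. \<forall>\<phi>. (LINT h|\<nu>. cinner (shift h u) \<phi>) = cinner g \<phi>"
  proof (rule riesz_representation)
    show "(LINT h|\<nu>. cinner (shift h u) (x + y)) =
        (LINT h|\<nu>. cinner (shift h u) x) + (LINT h|\<nu>. cinner (shift h u) y)" for x y
      by (simp add: cinner_add_right int)
    show "(LINT h|\<nu>. cinner (shift h u) (c *\<^sub>C x)) = cnj c * (LINT h|\<nu>. cinner (shift h u) x)" for c x
      by (simp add: cinner_scaleC_right)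
    show "cmod (LINT h|\<nu>. cinner (shift h u) x) \<le> norm u * norm x" for x
      using cmod_integral_cinner_shift_le[OF \<nu>, of u "\<lambda>_. 0" "norm u" x] by (simp add: norm_shift_le)
  qed
  then obtain g where g: "\<And>\<phi>. cinner g \<phi> = (LINT h|\<nu>. cinner (shift h u) \<phi>)" by metis
  have "\<exists>!g. has_pettis_integral \<nu> (\<lambda>h. shift h u) g"
  proof
    show "has_pettis_integral \<nu> (\<lambda>h. shift h u) g"
      by (simp add: has_pettis_integral_def g int)
    show "g' = g" if "has_pettis_integral \<nu> (\<lambda>h. shift h u) g'" for g'
      using that by (intro cinner_eqI) (simp add: has_pettis_integral_def g)
  qed
  then show ?thesis unfolding pettis_integral_def by (rule theI')
qed

definition average :: "'a measure \<Rightarrow> 'h \<Rightarrow> 'h" where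
  "average \<nu> u = pettis_integral \<nu> (\<lambda>h. shift h u)"

lemma cinner_average:
  assumes "prob_space \<nu>" "sets \<nu> = sets borel"
  shows "cinner (average \<nu> u) v = (LINT h|\<nu>. cinner (shift h u) v)"
  using has_pettis_integral_average[OF assms, of u] by (simp add: has_pettis_integral_def average_def)

lemma norm_average_diff_le:
  assumes \<nu>: "prob_space \<nu>" "sets \<nu> = sets borel"
  shows "norm (average \<nu> u - average \<nu> v) \<le> norm (u - v)"
proof -
  define \<phi> where "\<phi> = average \<nu> u - average \<nu> v"
  note int = integrable_cinner_shift[OF \<nu>]
  \<comment> \<open>The difference of the averages is tested against itself, so that contractivity
    of each single shift can act under the integral.\<close>
  have "cinner \<phi> \<phi> = (LINT h|\<nu>. cinner (shift h u - shift h v) \<phi>)"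
    unfolding \<phi>_def[THEN arg_cong, of "\<lambda>z. cinner z \<phi>"] cinner_diff_left cinner_average[OF \<nu>]
    by (rule Bochner_Integration.integral_diff[symmetric]) (rule int)+
  then have "(norm \<phi>)\<^sup>2 = cmod (LINT h|\<nu>. cinner (shift h u - shift h v) \<phi>)"
    by (metis cinner_self norm_of_real abs_of_nonneg zero_le_power2)
  also have "\<dots> \<le> norm (u - v) * norm \<phi>"
    by (rule cmod_integral_cinner_shift_le[OF \<nu>]) (auto simp: norm_shift_diff_le int)
  finally have "norm \<phi> * norm \<phi> \<le> norm (u - v) * norm \<phi>" by (simp add: power2_eq_square)
  then show ?thesis unfolding \<phi>_def[symmetric] by (cases "\<phi> = 0") auto
qed

text \<open>The shift \<open>h'\<close> stays in the second argument through both inductions, since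
  a later integration over it needs a bound uniform in \<open>h'\<close>. The rate may depend on
  \<open>f\<close> and \<open>g\<close> only, apart from \<open>\<sigma>\<close>.\<close>

lemma integral_cinner_shift_vanishes:
  assumes \<sigma>: "\<And>k. 0 < \<sigma> k" "\<And>k. \<sigma> k \<le> S" "\<not> summable \<sigma>"
    and f: "f \<in> block_combinations" and g: "g \<in> block_combinations"
  shows "\<exists>r. r \<longlonglongrightarrow> 0 \<and> (\<forall>N \<nu> h'. gaussian_coords e \<sigma> N \<nu> \<longrightarrow>
    cmod (LINT h|\<nu>. cinner (shift h (\<iota> f)) (shift h' (\<iota> g))) \<le> r N)"
proof -
  define small where "small u v \<longleftrightarrow> (\<exists>r. r \<longlonglongrightarrow> 0 \<and> (\<forall>N \<nu> h'. gaussian_coords e \<sigma> N \<nu> \<longrightarrow>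
    cmod (LINT h|\<nu>. cinner (shift h u) (shift h' v)) \<le> r N))" for u v
  have zero: "small 0 v" "small u 0" for u v
    unfolding small_def by (auto simp: shift_zero intro!: exI[of _ "\<lambda>_. 0"])
  have combine: "small u v"
    if "small u1 v1" "small u2 v2" and eq: "\<And>h h'. cinner (shift h u) (shift h' v) =
        c * cinner (shift h u1) (shift h' v1) + cinner (shift h u2) (shift h' v2)"
    for u v u1 v1 u2 v2 c
  proof -
    obtain r1 r2 where r: "r1 \<longlonglongrightarrow> 0" "r2 \<longlonglongrightarrow> 0"
      and b1: "\<And>N \<nu> h'. gaussian_coords e \<sigma> N \<nu> \<Longrightarrow> cmod (LINT h|\<nu>. cinner (shift h u1) (shift h' v1)) \<le> r1 N"
      and b2: "\<And>N \<nu> h'. gaussian_coords e \<sigma> N \<nu> \<Longrightarrow> cmod (LINT h|\<nu>. cinner (shift h u2) (shift h' v2)) \<le> r2 N"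
      using \<open>small u1 v1\<close> \<open>small u2 v2\<close> unfolding small_def by blast
    have "(\<lambda>N. cmod c * r1 N + r2 N) \<longlonglongrightarrow> cmod c * 0 + 0" by (intro tendsto_intros r)
    moreover have "cmod (LINT h|\<nu>. cinner (shift h u) (shift h' v)) \<le> cmod c * r1 N + r2 N"
      if gc: "gaussian_coords e \<sigma> N \<nu>" for N \<nu> h'
    proof -
      have \<nu>: "prob_space \<nu>" "sets \<nu> = sets borel" using gc by (auto simp: gaussian_coords_def)
      have "(LINT h|\<nu>. cinner (shift h u) (shift h' v)) =
          c * (LINT h|\<nu>. cinner (shift h u1) (shift h' v1)) + (LINT h|\<nu>. cinner (shift h u2) (shift h' v2))"
        unfolding eq using integrable_cinner_shift[OF \<nu>] by simp
      then show ?thesis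
        using b1[OF gc, of h'] b2[OF gc, of h']
        by (auto simp: norm_mult intro!: order.trans[OF norm_triangle_ineq] add_mono mult_left_mono)
    qed
    ultimately show ?thesis unfolding small_def by (intro exI[of _ "\<lambda>N. cmod c * r1 N + r2 N"]) simp
  qed
  have block_block: "small (\<iota> (indicator (block e a b))) (\<iota> (indicator (block e a' b')))"
    if B: "abs_measurable_bounds a b" and B': "abs_measurable_bounds a' b'" for a b a' b'
  proof -
    have R: "block e a b \<in> block_ring e" "block e a' b' \<in> block_ring e"
      using B B' by (simp_all add: abs_measurable_boundsD(4) abs_measurable_block_in_ring)
    have eq: "cinner (shift h (\<iota> (indicator (block e a b)))) (shift h' (\<iota> (indicator (block e a' b')))) =
        complex_of_real (\<mu> ((+) h ` block e a b \<inter> (+) h' ` block e a' b'))" for h h'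
      using R by (simp add: shift_\<iota> block_indicator_simples B B' indicator_translate
          translate_block_ring cinner_\<iota>_indicator)
    have "0 \<le> (LINT h|\<nu>. \<mu> ((+) h ` block e a b \<inter> (+) h' ` block e a' b'))" for \<nu> h'
      using R by (intro Bochner_Integration.integral_nonneg \<mu>_nonneg block_ring_Int translate_block_ring)
    then show ?thesis
      using integral_translated_block_Int_le[OF B B' \<sigma>]
      unfolding small_def eq integral_complex_of_real norm_of_real by simp
  qed
  have block: "small (\<iota> (indicator (block e a b))) (\<iota> g)" if B: "abs_measurable_bounds a b" for a b
    using g
  proof (induction rule: block_combinations.induct)
    case (add_block a' b' g c)
    \<comment> \<open>The coefficient is conjugated because the second argument of
      \<open>cinner\<close> is conjugate linear.\<close>
    show ?case
      by (rule combine[OF block_block[OF B add_block(1)] add_block.IH, of _ _ "cnj c"])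
        (simp add: shift_linear_simples block_combinations_simples[OF add_block(2)]
          block_indicator_simples[OF add_block(1)] cinner_add_right cinner_scaleC_right)
  qed (simp add: \<iota>_zero zero)
  have "small (\<iota> f) (\<iota> g)"
    using f
  proof (induction rule: block_combinations.induct)
    case (add_block a b f c)
    show ?case
      by (rule combine[OF block[OF add_block(1)] add_block.IH, of _ _ c])
        (simp add: shift_linear_simples block_combinations_simples[OF add_block(2)]
          block_indicator_simples[OF add_block(1)] cinner_add_left cinner_scaleC_left)
  qed (simp add: \<iota>_zero zero)
  then show ?thesis by (simp add: small_def)
qed

text \<open>On block combinations, \<open>\<parallel>U f\<parallel>\<^sup>2 = \<integral> (S\<^sub>h f, U f) d\<nu>(h)\<close>, and the integrand is the average over
  \<open>h'\<close> of \<open>(S\<^sub>h f, S\<^sub>h\<^sub>' f)\<close>; so weak bounds that are uniform in the second shift give norm bounds.\<close>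

lemma average_uniformly_small:
  assumes \<sigma>: "\<And>k. 0 < \<sigma> k" "\<And>k. \<sigma> k \<le> S" "\<not> summable \<sigma>" and \<epsilon>: "0 < \<epsilon>"
  shows "\<exists>N0. \<forall>N\<ge>N0. \<forall>\<nu>. gaussian_coords e \<sigma> N \<nu> \<longrightarrow> norm (average \<nu> u) < \<epsilon>"
proof -
  have "u \<in> closure (\<iota> ` block_combinations)" by (simp add: block_combinations_dense)
  \<comment> \<open>\<open>f\<close> depends on \<open>u\<close> and \<epsilon> alone, so its rate
    serves every measure; contractivity of averaging absorbs the approximation error.\<close>
  then obtain f where f: "f \<in> block_combinations" "norm (u - \<iota> f) < \<epsilon> / 2"
    unfolding closure_approachable using \<epsilon>
    by (metis dist_norm half_gt_zero imageE norm_minus_commute)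
  obtain r where r: "r \<longlonglongrightarrow> 0" and le: "\<And>N \<nu> h'. gaussian_coords e \<sigma> N \<nu> \<Longrightarrow>
    cmod (LINT h|\<nu>. cinner (shift h (\<iota> f)) (shift h' (\<iota> f))) \<le> r N"
    using integral_cinner_shift_vanishes[OF \<sigma> f(1) f(1)] by blast
  have "\<forall>\<^sub>F N in sequentially. r N < (\<epsilon> / 2)\<^sup>2"
    by (rule order_tendstoD(2)[OF r]) (use \<epsilon> in simp)
  then obtain N0 where N0: "\<And>N. N \<ge> N0 \<Longrightarrow> r N < (\<epsilon> / 2)\<^sup>2"
    unfolding eventually_sequentially by blast
  have "norm (average \<nu> u) < \<epsilon>" if N: "N \<ge> N0" and gc: "gaussian_coords e \<sigma> N \<nu>" for N \<nu>
  proof -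
    have \<nu>: "prob_space \<nu>" "sets \<nu> = sets borel" using gc by (auto simp: gaussian_coords_def)
    interpret prob_space \<nu> by fact
    define U where "U = average \<nu> (\<iota> f)"
    have int: "integrable \<nu> (\<lambda>h. cinner (shift h (\<iota> f)) U)" by (rule integrable_cinner_shift[OF \<nu>])
    have pt: "cmod (cinner (shift h' (\<iota> f)) U) \<le> r N" for h'
    proof -
      have "cmod (cinner (shift h' (\<iota> f)) U) = cmod (cinner U (shift h' (\<iota> f)))"
        by (subst cinner_commute) (rule complex_mod_cnj)
      then show ?thesis using le[OF gc, of h'] by (simp add: U_def cinner_average[OF \<nu>])
    qed
    have "complex_of_real ((norm U)\<^sup>2) = (LINT h|\<nu>. cinner (shift h (\<iota> f)) U)"
      unfolding cinner_self[symmetric] using cinner_average[OF \<nu>, of "\<iota> f" U] by (simp add: U_def)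
    then have "(norm U)\<^sup>2 = cmod (LINT h|\<nu>. cinner (shift h (\<iota> f)) U)"
      by (metis norm_of_real abs_of_nonneg zero_le_power2)
    also have "\<dots> \<le> (LINT h|\<nu>. cmod (cinner (shift h (\<iota> f)) U))" by (rule integral_norm_bound)
    also have "\<dots> \<le> (LINT h|\<nu>. r N)" by (rule integral_mono) (use int pt in auto)
    also have "\<dots> < (\<epsilon> / 2)\<^sup>2" using N0[OF N] by (simp add: prob_space)
    finally have "norm U < \<epsilon> / 2" by (rule power2_less_imp_less) (use \<epsilon> in simp)
    moreover have "norm (average \<nu> u - U) \<le> norm (u - \<iota> f)"
      unfolding U_def by (rule norm_average_diff_le[OF \<nu>])
    moreover have "norm (average \<nu> u) \<le> norm (average \<nu> u - U) + norm U"
      using norm_triangle_ineq[of "average \<nu> u - U" U] by simp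
    ultimately show ?thesis using f(2) by linarith
  qed
  then show ?thesis by blast
qed

end

theorem theorem5p2:
  fixes e :: "nat \<Rightarrow> 'a::{real_inner, complete_space}"
    and \<mu> :: "'a set \<Rightarrow> real"
    and \<iota> :: "('a \<Rightarrow> complex) \<Rightarrow> 'h::complex_hilbert"
    and D :: "'a \<Rightarrow> 'a"
  assumes "orthonormal_basis e"
    and "shift_invariant_measure e \<mu>"
    and "simple_funs_completion e \<mu> \<iota>"
    and "nuclear D" and "self_adjoint D" and "positive_definite D"
    and "\<forall>k. \<exists>d. D (e k) = d *\<^sub>R e k"
    and "\<not> nuclear (operator_sqrt D)"
  shows "(\<forall>t>0. \<forall>f. averaged_shift e \<mu> \<iota> (\<lambda>x. t *\<^sub>R D x) f = 0) \<and>
         (\<forall>f. (\<lambda>n. averaged_shift e \<mu> \<iota> (D \<circ> basis_proj e n) f) \<longlonglongrightarrow> 0 \<and>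
              averaged_shift e \<mu> \<iota> D f = 0)"
proof -
  interpret simple_completion e \<mu> \<iota> by unfold_locales (use assms in auto)
  obtain d where d: "\<And>k. D (e k) = d k *\<^sub>R e k" using assms(7) by metis
  have d_pos: "d k > 0" for k
  proof -
    have "e k \<noteq> 0" using inner_basis[of k k] by auto
    then have "D (e k) \<bullet> e k > 0" using assms(6) by (auto simp: positive_definite_def)
    then show ?thesis by (simp add: d inner_basis)
  qed
  have d_sum: "summable d"
    by (rule summable_eigenvalues_nuclear[OF assms(4) d]) (simp add: less_imp_le[OF d_pos])
  have sqrt_sum: "\<not> summable (\<lambda>k. sqrt (d k))"
    by (rule not_summable_sqrt_eigenvalues[OF assms(5) d d_pos d_sum assms(8)])
  have sqrt_le: "sqrt (d k) \<le> sqrt (suminf d)" for k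
    using sum_le_suminf[OF d_sum, of "{k}"] d_pos by (simp add: less_imp_le)
  have D_form: "(\<lambda>k. d k * ((x \<bullet> e k) * (y \<bullet> e k))) sums (D x \<bullet> y)" for x y
    using parseval[of "D x" y]
    by (simp add: self_adjoint_diagonal_coord[of D d, OF assms(5) d] mult.assoc)
  have avg: "averaged_shift e \<mu> \<iota> C f = average (gaussian_measure C) f" for C f
    by (simp add: averaged_shift_def average_def)
  have gauss: "centered_gaussian C (gaussian_measure C)" if "\<exists>\<nu>. centered_gaussian C \<nu>" for C :: "'a \<Rightarrow> 'a"
    unfolding gaussian_measure_def using that by (rule someI_ex)
  have zero: "averaged_shift e \<mu> \<iota> (\<lambda>x. t *\<^sub>R D x) f = 0" if t: "t > 0" for t f
  proof -
    let ?C = "\<lambda>x. t *\<^sub>R D x" and ?\<sigma> = "\<lambda>k. sqrt (t * d k)"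
    have C: "(\<lambda>k. (t * d k) * (\<xi> \<bullet> e k)\<^sup>2) sums (?C \<xi> \<bullet> \<xi>)" for \<xi>
      using sums_mult[OF D_form[of \<xi> \<xi>], of t] by (simp add: power2_eq_square mult_ac)
    have td: "0 < t * d k" for k using t d_pos by simp
    have "centered_gaussian ?C (gaussian_measure ?C)"
      by (intro gauss centered_gaussian_exists[OF _ _ C] summable_mult d_sum less_imp_le td)
    \<comment> \<open>The measure is fixed while \<open>N\<close> is free, so the average is smaller
      than every positive \<epsilon>.\<close>
    then have gc: "gaussian_coords e ?\<sigma> N (gaussian_measure ?C)" for N
      by (rule gaussian_coordsI[OF _ C]) (simp add: less_imp_le[OF td])
    have "norm (average (gaussian_measure ?C) f) < \<epsilon>" if "0 < \<epsilon>" for \<epsilon>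
    proof -
      have "\<exists>N0. \<forall>N\<ge>N0. \<forall>\<nu>. gaussian_coords e ?\<sigma> N \<nu> \<longrightarrow> norm (average \<nu> f) < \<epsilon>"
      proof (rule average_uniformly_small[OF _ _ _ that])
        show "0 < ?\<sigma> k" for k using td by simp
        show "?\<sigma> k \<le> sqrt t * sqrt (suminf d)" for k
          unfolding real_sqrt_mult by (intro mult_left_mono sqrt_le) (use t in simp)
        show "\<not> summable ?\<sigma>" using sqrt_sum t by (simp add: real_sqrt_mult summable_cmult_iff)
      qed
      then show ?thesis using gc by blast
    qed
    from less_irrefl this have "\<not> 0 < norm (average (gaussian_measure ?C) f)" by blast
    then show ?thesis by (simp add: avg)
  qed
  moreover have "(\<lambda>n. averaged_shift e \<mu> \<iota> (D \<circ> basis_proj e n) f) \<longlonglongrightarrow> 0" for f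
  proof -
    let ?C = "\<lambda>n. D \<circ> basis_proj e n" and ?\<sigma> = "\<lambda>k. sqrt (d k)"
    have C: "(\<lambda>k. (if k < n then d k else 0) * (\<xi> \<bullet> e k)\<^sup>2) sums (?C n \<xi> \<bullet> \<xi>)" for n \<xi>
    proof -
      have "(\<lambda>k. d k * ((basis_proj e n \<xi> \<bullet> e k) * (\<xi> \<bullet> e k))) = (\<lambda>k. (if k < n then d k else 0) * (\<xi> \<bullet> e k)\<^sup>2)"
        by (auto simp: inner_basis_proj power2_eq_square)
      then show ?thesis using D_form[of "basis_proj e n \<xi>" \<xi>] by (simp only: comp_apply)
    qed
    have "centered_gaussian (?C n) (gaussian_measure (?C n))" for n
      by (intro gauss centered_gaussian_exists[OF _ _ C] summable_finite[of "{..<n}"])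
        (auto simp: less_imp_le[OF d_pos])
    \<comment> \<open>Here \<open>N\<close> is tied to the truncation index \<open>n\<close>. The
      deviations \<open>?\<sigma>\<close> do not depend on \<open>n\<close> and stay positive from
      index \<open>n\<close> on, where the covariance vanishes.\<close>
    then have gc: "gaussian_coords e ?\<sigma> n (gaussian_measure (?C n))" for n
      by (rule gaussian_coordsI[OF _ C]) (simp add: less_imp_le[OF d_pos])
    show ?thesis
    proof (rule LIMSEQ_I)
      fix \<epsilon> :: real assume "0 < \<epsilon>"
      then obtain N0 where "\<forall>N\<ge>N0. \<forall>\<nu>. gaussian_coords e ?\<sigma> N \<nu> \<longrightarrow> norm (average \<nu> f) < \<epsilon>"
        using average_uniformly_small[of ?\<sigma> "sqrt (suminf d)" \<epsilon> f] d_pos sqrt_le sqrt_sum by auto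
      then show "\<exists>N0. \<forall>n\<ge>N0. norm (averaged_shift e \<mu> \<iota> (?C n) f - 0) < \<epsilon>"
        using gc by (auto simp: avg)
    qed
  qed
  moreover have "averaged_shift e \<mu> \<iota> D f = 0" for f using zero[of 1 f] by simp
  ultimately show ?thesis by blast
qed

end
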